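(* Let $\varphi : [0,\infty) \to \mathbb{R}$ be a continuous function that is $C^\infty$-smooth on $(0,\infty)$. For $t>0$ and integers $n \ge 0$ set $a_t(n) = (-1)^n \varphi^{(n)}(t)/n!$. Then the following are equivalent: (a) for every $t>0$ the sequence $(a_t(n))_{n\ge 0}$ is log-concave; (b) there exists a finite, log-concave measure $\mu$ on $[0,\infty)$ such that $\varphi(t) = \int_0^\infty e^{-tx}\, d\mu(x)$ for all $t \ge 0$.
   Context: A sequence $(a(n))_{n\ge 0}$ of real numbers is log-concave if all its terms are non-negative and $a(\lambda n + (1-\lambda) m) \ge a(n)^\lambda a(m)^{1-\lambda}$ for all integers $m,n\ge 0$ and all $\lambda\in(0,1)$ such that $\lambda n+(1-\lambda)m$ is an integer. Equivalently: the terms are non-negative, $a(n)^2 \ge a(n-1)a(n+1)$ for all $n\ge1$, and $\{n\ge 0 : a(n)>0\}$ is a (finite or infinite, possibly empty) interval of integers. A function $f:K\to\mathbb{R}$ on a convex set $K\subseteq\mathbb{R}^n$ is log-concave if $f\ge 0$ and $f(\lambda x+(1-\lambda)y)\ge f(x)^\lambda f(y)^{1-\lambda}$ for all $x,y\in K$, $0<\lambda<1$. A finite Borel measure $\mu$ on $[0,\infty)$ is log-concave if either $\mu = c\,\delta_{x_0}$ for some $c\ge 0$ and $x_0\in[0,\infty)$, or $\mu$ is absolutely continuous with a density $f:[0,\infty)\to\mathbb{R}$ that is a log-concave function. *)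

theory Defs
  imports "HOL-Probability.Probability"
begin

definition log_concave_seq :: "(nat \<Rightarrow> real) \<Rightarrow> bool" where
  "log_concave_seq a \<longleftrightarrow>
     (\<forall>n. 0 \<le> a n) \<and>
     (\<forall>m n k. \<forall>l\<in>{0<..<1}. real k = l * real n + (1 - l) * real m
        \<longrightarrow> a n powr l * a m powr (1 - l) \<le> a k)"

definition log_concave_on :: "'a::real_vector set \<Rightarrow> ('a \<Rightarrow> real) \<Rightarrow> bool" where
  "log_concave_on K f \<longleftrightarrow>
     convex K \<and>
     (\<forall>x\<in>K. 0 \<le> f x) \<and>
     (\<forall>x\<in>K. \<forall>y\<in>K. \<forall>l\<in>{0<..<1}.
        f x powr l * f y powr (1 - l) \<le> f (l *\<^sub>R x + (1 - l) *\<^sub>R y))"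

(* Measures on [0,\<infinity>) live on the subspace, so they have space {0..}. Measurability of the
   density is stated explicitly because density M f is only meaningful for measurable f. *)
definition log_concave_measure :: "real measure \<Rightarrow> bool" where
  "log_concave_measure \<mu> \<longleftrightarrow>
     (\<exists>c x0. 0 \<le> c \<and> 0 \<le> x0 \<and>
        \<mu> = scale_measure (ennreal c) (return (restrict_space borel {0..}) x0)) \<or>
     (\<exists>f. f \<in> borel_measurable (restrict_space borel {0..}) \<and> log_concave_on {0..} f \<and>
        \<mu> = density (restrict_space lborel {0..}) (\<lambda>x. ennreal (f x)))"

(* (-1)^n \<phi>^(n)(t) / n!. For t > 0 the iterated deriv only depends on \<phi> near t, so the values
   of \<phi> at negative reals, where the mathematical function is undefined, play no role. *)
definition taylor_seq :: "(real \<Rightarrow> real) \<Rightarrow> real \<Rightarrow> nat \<Rightarrow> real" where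
  "taylor_seq \<phi> t n = (- 1) ^ n * (deriv ^^ n) \<phi> t / fact n"

end

theory Submission
  imports Defs "HOL-Complex_Analysis.Great_Picard" "HOL-Real_Asymp.Real_Asymp"
begin

text \<open>
  Both directions rest on describing log-concavity by products: a sequence is log-concave iff
  \<open>p i * p (j+1) \<le> p (i+1) * p j\<close> for \<open>i \<le> j\<close> (\<open>pf2_seq\<close>), and a log-concave function satisfies
  \<open>f x * f (y+s) \<le> f y * f (x+s)\<close> for \<open>x \<le> y\<close> (\<open>cross_ineq\<close>). Such inequalities can be added and
  integrated directly, unlike those with real powers.

  If \<open>\<phi>\<close> is the Laplace transform of \<open>\<mu>\<close>, differentiation under the integral identifies the Taylor
  sequence at \<open>t\<close> with the normalised moments \<open>\<integral>x\<^sup>n / n! * exp (-t x) \<partial>\<mu>\<close>. For a point mass these are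
  explicit. For a density \<open>f\<close>, absorb the factor \<open>exp (-t x)\<close>, which keeps \<open>f\<close> log-concave; the n-th
  normalised moment is then the value at 0 of the (n+1)-fold iterated tail integral of \<open>f\<close>. Taking
  tail integrals preserves log-concavity, and for a log-concave \<open>F\<close> with tail integral \<open>T\<close> the
  ratio \<open>T / F\<close> decreases, which integrates to \<open>F 0 * \<integral>T \<le> T 0 * T 0\<close>: consecutive moments satisfy the
  required inequality (\<open>moment_log_concave\<close>).

  Conversely, suppose that all Taylor sequences \<open>a\<^sub>t\<close> are log-concave. They are nonnegative, so \<open>\<phi>\<close>
  is completely monotone, and Bernstein's remainder estimate shows that the Taylor series at \<open>r\<close>
  converges to \<open>\<phi>\<close> on all of \<open>(0, r]\<close>. Consider the mixture \<open>g\<^sub>r\<close> of the densities of the gamma laws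
  with shape \<open>n+1\<close> and rate \<open>r\<close>, with weights \<open>a\<^sub>r n * r\<^sup>n\<close>. Summing the Taylor series gives its
  Laplace transform in closed form, \<open>r/(r+s) * \<phi> (r s/(r+s))\<close>, which tends to \<open>\<phi> s\<close> as \<open>r\<close> grows, and
  its total mass is at most \<open>\<phi> 0\<close>. Moreover \<open>g\<^sub>r\<close> is a log-concave function: up to an exponential factor
  and scaling it is \<open>u x = \<Sum>a\<^sub>r n * x\<^sup>n / n!\<close>, the derivatives of \<open>u\<close> at \<open>x\<close> form the image of the
  sequence \<open>a\<^sub>r\<close> under \<open>exp (x * Shift)\<close>, and \<open>1 + e * Shift\<close> preserves log-concave sequences, hence so
  does its limit \<open>exp (x * Shift)\<close>; therefore \<open>u * u'' \<le> u' * u'\<close>.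

  It remains to pass to the limit in a sequence of log-concave functions of bounded mass
  (\<open>limit_dichotomy\<close>). Either there are two points at which the functions stay above a positive
  constant along a subsequence. The mass bound then forces a uniform bound, a further
  subsequence converges at all rationals, log-concavity propagates this to almost every point,
  and dominated convergence shows that \<open>\<phi>\<close> is the Laplace transform of the log-concave pointwise lower
  limit. Or the superlevel sets shrink to points on bounded intervals, and \<open>\<phi> s\<close> is a limit of \<open>m\<^sub>k * exp (-s u\<^sub>k)\<close>, so it
  is the transform of a point mass. The value at 0 follows by continuity and monotone convergence.
\<close>

section \<open>Log-concave sequences as sequences with nonnegative two-by-two minors\<close>

text \<open>
  This is total positivity of order two of the Toeplitz matrix of \<open>p\<close>. Comparing distant indices \<open>i\<close>
  and \<open>j\<close>, rather than only neighbours, rules out zeros between positive terms, so that the support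
  is an interval.
\<close>
definition pf2_seq :: "(nat \<Rightarrow> real) \<Rightarrow> bool" where
  "pf2_seq p \<longleftrightarrow> (\<forall>n. 0 \<le> p n) \<and> (\<forall>i j. i \<le> j \<longrightarrow> p i * p (Suc j) \<le> p (Suc i) * p j)"

lemma pf2_seqD:
  assumes "pf2_seq p"
  shows "0 \<le> p n" and "i \<le> j \<Longrightarrow> p i * p (Suc j) \<le> p (Suc i) * p j"
  using assms by (auto simp: pf2_seq_def)

text \<open>
  Two instances of the power inequality with swapped weights multiply to a plain product; this
  is how real powers are eliminated both for sequences and for functions.
\<close>
lemma powr_cross_combine:
  fixes a b :: real
  assumes "0 \<le> a" "0 \<le> b"
  shows "(a powr l * b powr (1 - l)) * (a powr (1 - l) * b powr l) = a * b"
proof (cases "a = 0 \<or> b = 0")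
  case False
  have "(a powr l * b powr (1 - l)) * (a powr (1 - l) * b powr l)
     = (a powr l * a powr (1 - l)) * (b powr (1 - l) * b powr l)" by (simp add: mult_ac)
  also have "\<dots> = a * b" using False assms by (simp flip: powr_add)
  finally show ?thesis .
qed auto

lemma log_concave_seq_imp_pf2_seq:
  assumes "log_concave_seq p"
  shows "pf2_seq p"
  unfolding pf2_seq_def
proof (intro conjI allI impI)
  show nn: "0 \<le> p n" for n using assms by (auto simp: log_concave_seq_def)
  fix i j :: nat assume ij: "i \<le> j"
  show "p i * p (Suc j) \<le> p (Suc i) * p j"
  proof (cases "i = j")
    case False
    define D where "D = real (Suc j) - real i"
    define l where "l = (D - 1) / D"
    have D: "D > 1" using ij False by (simp add: D_def)
    then have l: "l \<in> {0<..<1}" by (simp add: l_def)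
    have L: "l * D = D - 1" using D by (simp add: l_def)
    \<comment> \<open>The inner indices \<open>i+1\<close> and \<open>j\<close> divide the interval from \<open>i\<close> to \<open>j+1\<close> symmetrically.\<close>
    have 1: "real (Suc i) = l * real i + (1 - l) * real (Suc j)"
      using L unfolding D_def by (simp add: algebra_simps)
    have 2: "real j = (1 - l) * real i + (1 - (1 - l)) * real (Suc j)"
      using L unfolding D_def by (simp add: algebra_simps)
    have l': "1 - l \<in> {0<..<1}" using l by auto
    have "p i powr l * p (Suc j) powr (1 - l) \<le> p (Suc i)"
      using assms l 1 unfolding log_concave_seq_def by blast
    moreover have "p i powr (1 - l) * p (Suc j) powr (1 - (1 - l)) \<le> p j"
      using assms l' 2 unfolding log_concave_seq_def by blast
    ultimately have "(p i powr l * p (Suc j) powr (1 - l)) * (p i powr (1 - l) * p (Suc j) powr l)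
        \<le> p (Suc i) * p j"
      using nn by (intro mult_mono) (auto)
    then show ?thesis using powr_cross_combine[OF nn nn] by simp
  qed (simp add: mult.commute)
qed

text \<open>
  Since the ratios of consecutive terms decrease, the geometric progression with the ratio at
  \<open>i\<close> dominates \<open>p\<close> on both sides of \<open>i\<close>.
\<close>
lemma pf2_seq_ratio_powers:
  assumes p: "pf2_seq p" and "p i > 0" "p (Suc i) > 0"
  shows "d \<le> i \<Longrightarrow> p (i - d) * (p (Suc i) / p i) ^ d \<le> p i"
    and "p (Suc i + d) \<le> p (Suc i) * (p (Suc i) / p i) ^ d"
proof -
  show "p (i - d) * (p (Suc i) / p i) ^ d \<le> p i" if "d \<le> i"
    using that
  proof (induction d)
    case (Suc d)
    have "p (i - Suc d) * p (Suc i) \<le> p (i - d) * p i"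
      using pf2_seqD(2)[OF p, of "i - Suc d" i] Suc.prems by (simp add: Suc_diff_Suc)
    then have "p (i - Suc d) * (p (Suc i) / p i) \<le> p (i - d)"
      using assms by (simp add: field_simps)
    then have "p (i - Suc d) * (p (Suc i) / p i) * (p (Suc i) / p i) ^ d \<le> p (i - d) * (p (Suc i) / p i) ^ d"
      using assms by (intro mult_right_mono) auto
    also have "\<dots> \<le> p i" using Suc by simp
    finally show ?case by (simp add: mult_ac)
  qed simp
  show "p (Suc i + d) \<le> p (Suc i) * (p (Suc i) / p i) ^ d"
  proof (induction d)
    case (Suc d)
    have "p i * p (Suc (Suc i + d)) \<le> p (Suc i) * p (Suc i + d)"
      using pf2_seqD(2)[OF p, of i "Suc i + d"] by simp
    then have "p (Suc (Suc i + d)) \<le> p (Suc i + d) * (p (Suc i) / p i)"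
      using assms by (simp add: field_simps)
    also have "\<dots> \<le> p (Suc i) * (p (Suc i) / p i) ^ d * (p (Suc i) / p i)"
      using Suc assms by (intro mult_right_mono) auto
    finally show ?case by (simp add: mult_ac)
  qed simp
qed

lemma pf2_seq_no_internal_zeros:
  assumes p: "pf2_seq p" and "p n > 0" "p m > 0" "n \<le> k" "k \<le> m"
  shows "p k > 0"
proof (rule ccontr)
  assume "\<not> p k > 0"
  then have k0: "p k = 0" using pf2_seqD(1)[OF p, of k] by simp
  \<comment> \<open>At the first zero \<open>q\<close> after \<open>n\<close>, the minor with indices \<open>q-1\<close> and \<open>m-1\<close> is violated.\<close>
  define P where "P = (\<lambda>i. n \<le> i \<and> p i = 0)"
  define q where "q = (LEAST i. P i)"
  have "P k" using k0 assms by (simp add: P_def)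
  then have q: "P q" "q \<le> k" unfolding q_def by (auto intro: LeastI Least_le)
  have "q \<noteq> n" using q assms by (auto simp: P_def)
  then have "q > n" using q by (simp add: P_def)
  then have "\<not> P (q - 1)" using not_less_Least[of "q - 1" P] unfolding q_def[symmetric] by auto
  then have pos: "p (q - 1) > 0"
    using pf2_seqD(1)[OF p, of "q - 1"] \<open>q > n\<close> by (auto simp: P_def)
  have "p (q - 1) * p (Suc (m - 1)) \<le> p (Suc (q - 1)) * p (m - 1)"
    using q(2) assms by (intro pf2_seqD(2)[OF p]) auto
  also have "Suc (q - 1) = q" using \<open>q > n\<close> by simp
  also have "Suc (m - 1) = m" using \<open>q > n\<close> assms q by simp
  also have "p q = 0" using q by (simp add: P_def)
  finally show False using pos assms by (simp add: mult_le_0_iff)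
qed

text \<open>
  The geometric progression through \<open>p k\<close> with ratio \<open>p (k+1) / p k\<close> lies above \<open>p\<close> at \<open>n\<close> and at \<open>m\<close>, and for a
  geometric progression the weighted inequality is an equality.
\<close>
lemma pf2_seq_weighted:
  assumes p: "pf2_seq p" and nk: "n < k" "k < m" and l: "l \<in> {0<..<1}"
    and k: "real k = l * real n + (1 - l) * real m"
  shows "p n powr l * p m powr (1 - l) \<le> p k"
proof (cases "p n = 0 \<or> p m = 0")
  case True
  then show ?thesis using pf2_seqD(1)[OF p, of k] l by auto
next
  case False
  then have pos: "p n > 0" "p m > 0" using pf2_seqD(1)[OF p] by (auto simp: less_le)
  have all: "p i > 0" if "n \<le> i" "i \<le> m" for i
    using pf2_seq_no_internal_zeros[OF p pos that] .
  define r where "r = p (Suc k) / p k"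
  have pk: "p k > 0" "p (Suc k) > 0" using all[of k] all[of "Suc k"] nk by auto
  have r: "r > 0" using pk by (simp add: r_def)
  have L: "p n * r ^ (k - n) \<le> p k"
    using pf2_seq_ratio_powers(1)[OF p pk, of "k - n"] nk by (simp add: r_def)
  have "p m \<le> p (Suc k) * r ^ (m - Suc k)"
    using pf2_seq_ratio_powers(2)[OF p pk, of "m - Suc k"] nk by (simp add: r_def)
  also have "p (Suc k) = p k * r" using pk by (simp add: r_def)
  also have "p k * r * r ^ (m - Suc k) = p k * r ^ (m - k)"
    using nk by (simp add: Suc_diff_Suc flip: power_Suc mult.assoc)
  finally have R: "p m \<le> p k * r ^ (m - k)" .
  have "p n \<le> p k * r powr - real (k - n)"
    using L r by (simp add: powr_minus powr_realpow field_simps)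
  then have "p n powr l \<le> (p k * r powr - real (k - n)) powr l"
    using l pos by (intro powr_mono2) auto
  moreover have "p m powr (1 - l) \<le> (p k * r powr real (m - k)) powr (1 - l)"
    using l pos R r by (intro powr_mono2) (auto simp: powr_realpow)
  ultimately have "p n powr l * p m powr (1 - l)
      \<le> (p k * r powr - real (k - n)) powr l * (p k * r powr real (m - k)) powr (1 - l)"
    by (intro mult_mono) auto
  also have "\<dots> = (p k powr l * p k powr (1 - l)) * (r powr (- real (k - n) * l) * r powr (real (m - k) * (1 - l)))"
    using pk r by (simp add: powr_mult powr_powr mult_ac)
  also have "\<dots> = p k * r powr (- real (k - n) * l + real (m - k) * (1 - l))"
    using pk by (simp flip: powr_add)
  also have "- real (k - n) * l + real (m - k) * (1 - l) = 0"
    using nk k by (simp add: of_nat_diff) (simp add: algebra_simps)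
  finally show ?thesis using r by simp
qed

lemma pf2_seq_imp_log_concave_seq:
  assumes p: "pf2_seq p"
  shows "log_concave_seq p"
  unfolding log_concave_seq_def
proof (intro conjI allI ballI impI)
  show "0 \<le> p n" for n using pf2_seqD(1)[OF p] .
  fix m n k :: nat and l :: real
  assume l: "l \<in> {0<..<1}" and k: "real k = l * real n + (1 - l) * real m"
  consider "n = m" | "n < m" | "m < n" by linarith
  then show "p n powr l * p m powr (1 - l) \<le> p k"
  proof cases
    case 1
    then have "k = n" using k by (simp add: algebra_simps)
    then show ?thesis using 1 pf2_seqD(1)[OF p, of n]
      by (cases "p n = 0") (auto simp flip: powr_add)
  next
    case 2
    have "real k - real n = (1 - l) * (real m - real n)" "real m - real k = l * (real m - real n)"
      using k by (auto simp: algebra_simps)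
    then have "real k - real n > 0" "real m - real k > 0" using 2 l by auto
    then show ?thesis using pf2_seq_weighted[OF p _ _ l k] by simp
  next
    case 3
    have "real k - real m = l * (real n - real m)" "real n - real k = (1 - l) * (real n - real m)"
      using k by (auto simp: algebra_simps)
    then have "real k - real m > 0" "real n - real k > 0" using 3 l by auto
    then have "p m powr (1 - l) * p n powr (1 - (1 - l)) \<le> p k"
      using l k by (intro pf2_seq_weighted[OF p]) auto
    then show ?thesis by (simp add: mult.commute)
  qed
qed

lemma pf2_seq_of_pos:
  assumes pos: "\<And>n. 0 < p n" and step: "\<And>n. p n * p (Suc (Suc n)) \<le> p (Suc n) * p (Suc n)"
  shows "pf2_seq p"
  unfolding pf2_seq_def
proof (intro conjI allI impI)
  show "0 \<le> p n" for n using pos[of n] by simp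
  have "decseq (\<lambda>n. p (Suc n) / p n)"
    unfolding decseq_Suc_iff using pos step by (auto simp: field_simps)
  then show "p i * p (Suc j) \<le> p (Suc i) * p j" if "i \<le> j" for i j
    using pos[of i] pos[of j] decseqD[OF _ that, of "\<lambda>n. p (Suc n) / p n"] by (simp add: field_simps)
qed

section \<open>Moments of log-concave densities\<close>

definition tail_integral :: "(real \<Rightarrow> ennreal) \<Rightarrow> real \<Rightarrow> ennreal" where
  "tail_integral f x = (\<integral>\<^sup>+v. (if x \<le> v then f v else 0) \<partial>lborel)"

definition moment :: "nat \<Rightarrow> (real \<Rightarrow> ennreal) \<Rightarrow> ennreal" where
  "moment n f = (\<integral>\<^sup>+x. (if 0 \<le> x then ennreal (x ^ n / fact n) * f x else 0) \<partial>lborel)"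

text \<open>
  Values in \<open>ennreal\<close> keep the inequality meaningful for iterated tail integrals, which may be
  infinite.
\<close>
definition cross_ineq :: "(real \<Rightarrow> ennreal) \<Rightarrow> bool" where
  "cross_ineq f \<longleftrightarrow> (\<forall>x y s. 0 \<le> x \<longrightarrow> x \<le> y \<longrightarrow> 0 \<le> s \<longrightarrow> f x * f (y + s) \<le> f y * f (x + s))"

lemma cross_ineqD: "cross_ineq f \<Longrightarrow> 0 \<le> x \<Longrightarrow> x \<le> y \<Longrightarrow> 0 \<le> s \<Longrightarrow> f x * f (y + s) \<le> f y * f (x + s)"
  by (simp add: cross_ineq_def)

lemma tail_integral_measurable [measurable]:
  assumes [measurable]: "f \<in> borel_measurable borel"
  shows "tail_integral f \<in> borel_measurable borel"
  unfolding tail_integral_def by measurable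

lemma tail_integral_shift:
  assumes [measurable]: "f \<in> borel_measurable borel"
  shows "tail_integral f (x + a) = (\<integral>\<^sup>+u. (if a \<le> u then f (x + u) else 0) \<partial>lborel)"
  unfolding tail_integral_def
  by (subst nn_integral_real_affine[where c = 1 and t = x]) (auto intro!: nn_integral_cong)

lemma tail_integral_split:
  assumes [measurable]: "f \<in> borel_measurable borel" and "0 \<le> s"
  shows "tail_integral f x
     = (\<integral>\<^sup>+u. (if 0 \<le> u \<and> u < s then f (x + u) else 0) \<partial>lborel) + tail_integral f (x + s)"
proof -
  have "tail_integral f x = tail_integral f (x + 0)" by simp
  also have "\<dots> = (\<integral>\<^sup>+u. (if 0 \<le> u \<and> u < s then f (x + u) else 0) + (if s \<le> u then f (x + u) else 0) \<partial>lborel)"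
    unfolding tail_integral_shift[OF assms(1)] using assms(2) by (intro nn_integral_cong) auto
  also have "\<dots> = (\<integral>\<^sup>+u. (if 0 \<le> u \<and> u < s then f (x + u) else 0) \<partial>lborel) + tail_integral f (x + s)"
    unfolding tail_integral_shift[OF assms(1)] by (intro nn_integral_add) measurable
  finally show ?thesis .
qed

text \<open>
  The ratio of tail integral to function decreases: integrate the cross inequality over \<open>s\<close>.
\<close>
lemma tail_integral_hazard:
  assumes [measurable]: "f \<in> borel_measurable borel" and f: "cross_ineq f" and "0 \<le> x" "x \<le> y"
  shows "f x * tail_integral f y \<le> f y * tail_integral f x"
proof -
  have "f x * tail_integral f (y + 0) \<le> f y * tail_integral f (x + 0)"
    unfolding tail_integral_shift[OF assms(1)]
    by (subst (1 2) nn_integral_cmult[symmetric])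
      (auto intro!: nn_integral_mono cross_ineqD[OF f] assms)
  then show ?thesis by simp
qed

text \<open>
  Cut both tails at \<open>s\<close>. The products of the two remaining tails cancel, and in the remaining double
  integrals the arguments \<open>x+u\<close> and \<open>y+w\<close> with \<open>u < s \<le> w\<close> are the outermost ones of the four, so
  the cross inequality applies pointwise. Adding the common product back, instead of subtracting,
  avoids differences of possibly infinite values.
\<close>
lemma cross_ineq_tail_integral:
  assumes [measurable]: "f \<in> borel_measurable borel" and f: "cross_ineq f"
  shows "cross_ineq (tail_integral f)"
  unfolding cross_ineq_def
proof (intro allI impI)
  fix x y s :: real assume xys: "0 \<le> x" "x \<le> y" "0 \<le> s"
  let ?G = "tail_integral f"
  let ?W = "\<lambda>x. \<integral>\<^sup>+u. (if 0 \<le> u \<and> u < s then f (x + u) else 0) \<partial>lborel"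
  have pt: "f (x + u) * ?G (y + s) \<le> f (y + u) * ?G (x + s)" if u: "0 \<le> u" "u < s" for u
    unfolding tail_integral_shift[OF assms(1)]
  proof (subst (1 2) nn_integral_cmult[symmetric], measurable, measurable, rule nn_integral_mono)
    fix w :: real
    show "f (x + u) * (if s \<le> w then f (y + w) else 0) \<le> f (y + u) * (if s \<le> w then f (x + w) else 0)"
      using cross_ineqD[OF f, of "x + u" "y + u" "w - u"] xys u by auto
  qed
  have "?W x * ?G (y + s) \<le> ?W y * ?G (x + s)"
    by (subst (1 2) nn_integral_multc[symmetric], measurable, rule nn_integral_mono) (use pt in auto)
  then have "?W x * ?G (y + s) + ?G (x + s) * ?G (y + s) \<le> ?W y * ?G (x + s) + ?G (x + s) * ?G (y + s)"
    by (rule add_right_mono)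
  then show "?G x * ?G (y + s) \<le> ?G y * ?G (x + s)"
    unfolding tail_integral_split[OF assms(1) xys(3), of x] tail_integral_split[OF assms(1) xys(3), of y]
    by (simp add: algebra_simps)
qed

lemma moment_0: "moment 0 f = tail_integral f 0"
  by (simp add: moment_def tail_integral_def cong: if_cong)

text \<open>
  Since \<open>x\<^sup>n\<^sup>+\<^sup>1 / (n+1)!\<close> is the integral of \<open>u\<^sup>n / n!\<close> over \<open>[0, x]\<close>, Tonelli's theorem trades one power of \<open>x\<close> for one
  tail integral.
\<close>
lemma moment_Suc:
  assumes [measurable]: "f \<in> borel_measurable borel"
  shows "moment (Suc n) f = moment n (tail_integral f)"
proof -
  have pw: "(\<integral>\<^sup>+x. (if 0 \<le> x \<and> x \<le> v then ennreal (x ^ n / fact n) else 0) \<partial>lborel)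
      = ennreal (v ^ Suc n / fact (Suc n))" if "0 \<le> v" for v :: real
  proof -
    have "(\<integral>\<^sup>+x. ennreal (x ^ n / fact n) * indicator {0..v} x \<partial>lborel) 
       = ennreal (v ^ Suc n / fact (Suc n) - 0 ^ Suc n / fact (Suc n))"
    proof (rule nn_integral_FTC_Icc)
      have "((\<lambda>x. x ^ Suc n / fact (Suc n)) has_real_derivative (real (Suc n) * x ^ n / fact (Suc n))) (at x)" for x :: real
        by (auto intro!: derivative_eq_intros simp del: fact_Suc power_Suc)
      moreover have "real (Suc n) * x ^ n / fact (Suc n) = x ^ n / fact n" for x :: real
        by (simp add: divide_simps del: of_nat_Suc)
      ultimately show "((\<lambda>x. x ^ Suc n / fact (Suc n)) has_real_derivative x ^ n / fact n) (at x)" for x :: real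
        by metis
    qed (use that in auto)
    also have "(\<integral>\<^sup>+x. ennreal (x ^ n / fact n) * indicator {0..v} x \<partial>lborel)
      = (\<integral>\<^sup>+x. (if 0 \<le> x \<and> x \<le> v then ennreal (x ^ n / fact n) else 0) \<partial>lborel)"
      by (intro nn_integral_cong) auto
    finally show ?thesis by simp
  qed
  have "moment n (tail_integral f)
     = (\<integral>\<^sup>+x. (\<integral>\<^sup>+v. (if 0 \<le> x \<and> x \<le> v then ennreal (x ^ n / fact n) * f v else 0) \<partial>lborel) \<partial>lborel)"
    unfolding moment_def tail_integral_def
    by (intro nn_integral_cong, simp, intro impI conjI)
       (subst nn_integral_cmult[symmetric]; auto intro!: nn_integral_cong)
  also have "\<dots> = (\<integral>\<^sup>+v. (\<integral>\<^sup>+x. (if 0 \<le> x \<and> x \<le> v then ennreal (x ^ n / fact n) * f v else 0) \<partial>lborel) \<partial>lborel)"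
    by (intro lborel_pair.Fubini') measurable
  also have "\<dots> = moment (Suc n) f"
    unfolding moment_def
  proof (intro nn_integral_cong)
    fix v :: real
    show "(\<integral>\<^sup>+x. (if 0 \<le> x \<and> x \<le> v then ennreal (x ^ n / fact n) * f v else 0) \<partial>lborel)
       = (if 0 \<le> v then ennreal (v ^ Suc n / fact (Suc n)) * f v else 0)"
    proof (cases "0 \<le> v")
      case True
      have "(\<integral>\<^sup>+x. (if 0 \<le> x \<and> x \<le> v then ennreal (x ^ n / fact n) * f v else 0) \<partial>lborel)
        = (\<integral>\<^sup>+x. (if 0 \<le> x \<and> x \<le> v then ennreal (x ^ n / fact n) else 0) * f v \<partial>lborel)"
        by (intro nn_integral_cong) auto
      also have "\<dots> = ennreal (v ^ Suc n / fact (Suc n)) * f v"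
        by (subst nn_integral_multc) (use True in \<open>simp_all add: pw\<close>)
      finally show ?thesis using True by simp
    next
      case False
      then have "(\<lambda>x. if 0 \<le> x \<and> x \<le> v then ennreal (x ^ n / fact n) * f v else 0) = (\<lambda>x. 0)"
        by auto
      then show ?thesis using False by simp
    qed
  qed
  finally show ?thesis by simp
qed

text \<open>
  Passing to tail integrals lowers the index, so only \<open>n = 0\<close> needs an argument: there the three
  moments are \<open>G 0\<close>, \<open>H 0\<close> and \<open>\<integral>H\<close> for the first and second tail integrals \<open>G\<close> and \<open>H\<close>, and integrating
  \<open>G 0 * H y \<le> G y * H 0\<close> over \<open>y\<close> gives the claim.
\<close>
lemma moment_log_concave:
  assumes "f \<in> borel_measurable borel" and "cross_ineq f"
  shows "moment n f * moment (Suc (Suc n)) f \<le> moment (Suc n) f * moment (Suc n) f"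
  using assms
proof (induction n arbitrary: f)
  case 0
  note [measurable] = 0(1)
  let ?G = "tail_integral f" let ?H = "tail_integral ?G"
  have [measurable]: "?G \<in> borel_measurable borel" by measurable
  have "?G 0 * tail_integral ?H 0 = (\<integral>\<^sup>+y. ?G 0 * (if 0 \<le> y then ?H y else 0) \<partial>lborel)"
    unfolding tail_integral_def[of ?H] by (intro nn_integral_cmult[symmetric]) measurable
  also have "\<dots> \<le> (\<integral>\<^sup>+y. (if 0 \<le> y then ?G y else 0) * ?H 0 \<partial>lborel)"
    using tail_integral_hazard[OF _ cross_ineq_tail_integral[OF 0]] by (intro nn_integral_mono) auto
  also have "\<dots> = ?H 0 * ?H 0"
    by (subst nn_integral_multc, measurable) (simp add: tail_integral_def[of ?G 0])
  finally show ?case by (simp add: moment_Suc moment_0)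
next
  case (Suc n)
  have "tail_integral f \<in> borel_measurable borel" using Suc by measurable
  then show ?case 
    using Suc.IH[OF _ cross_ineq_tail_integral[OF Suc.prems]] Suc.prems by (simp add: moment_Suc)
qed

lemma log_concave_on_imp_cross_ineq:
  assumes h: "log_concave_on {0..} h"
  shows "cross_ineq (\<lambda>x. ennreal (h x * exp (- t * x)))"
  unfolding cross_ineq_def
proof (intro allI impI)
  fix x y s :: real assume xys: "0 \<le> x" "x \<le> y" "0 \<le> s"
  have nn: "h z \<ge> 0" if "z \<ge> 0" for z using h that by (auto simp: log_concave_on_def)
  have "h x * h (y + s) \<le> h y * h (x + s)"
  proof (cases "x = y \<or> s = 0")
    case False
    \<comment> \<open>With this weight, \<open>y\<close> and \<open>x+s\<close> are the two mirror-image combinations of \<open>x\<close> and \<open>y+s\<close>.\<close>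
    define l where "l = s / (y - x + s)"
    have l: "l \<in> {0<..<1}" "1 - l \<in> {0<..<1}" using xys False by (auto simp: l_def field_simps)
    have L: "l * (y - x + s) = s" using xys False by (simp add: l_def)
    have "h x powr m * h (y + s) powr (1 - m) \<le> h (m *\<^sub>R x + (1 - m) *\<^sub>R (y + s))" if "m \<in> {0<..<1}" for m
      using h xys that unfolding log_concave_on_def by (auto simp del: real_scaleR_def)
    note this[OF l(1)] this[OF l(2)]
    moreover have "l *\<^sub>R x + (1 - l) *\<^sub>R (y + s) = y" "(1 - l) *\<^sub>R x + (1 - (1 - l)) *\<^sub>R (y + s) = x + s"
      using L by (auto simp: algebra_simps)
    ultimately have "(h x powr l * h (y + s) powr (1 - l)) * (h x powr (1 - l) * h (y + s) powr l) \<le> h y * h (x + s)"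
      using nn xys by (intro mult_mono) auto
    then show ?thesis using powr_cross_combine[OF nn[of x] nn[of "y + s"]] xys by simp
  qed (auto simp: mult.commute)
  then have le: "h x * h (y + s) * (exp (- t * x) * exp (- t * (y + s))) \<le> h y * h (x + s) * (exp (- t * x) * exp (- t * (y + s)))"
    by (rule mult_right_mono) simp
  have e: "exp (- t * x) * exp (- t * (y + s)) = exp (- t * y) * exp (- t * (x + s))"
    by (simp flip: exp_add) (simp add: algebra_simps)
  have "h x * h (y + s) * (exp (- t * x) * exp (- t * (y + s))) \<le> h y * h (x + s) * (exp (- t * y) * exp (- t * (x + s)))"
    using le unfolding e .
  then have "(h x * exp (- t * x)) * (h (y + s) * exp (- t * (y + s))) \<le> (h y * exp (- t * y)) * (h (x + s) * exp (- t * (x + s)))"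
    by (simp only: mult_ac)
  then show "ennreal (h x * exp (- t * x)) * ennreal (h (y + s) * exp (- t * (y + s)))
     \<le> ennreal (h y * exp (- t * y)) * ennreal (h (x + s) * exp (- t * (x + s)))"
    using nn xys by (simp flip: ennreal_mult)
qed

section \<open>Derivatives of the Laplace transform of a finite measure\<close>

text \<open>
  The error bound for difference quotients under the integral sign: with \<open>y = -h x\<close> the factor \<open>exp \<bar>y\<bar>\<close> is
  absorbed by \<open>exp (-t x)\<close> as long as \<open>h\<close> is small compared with \<open>t\<close>.
\<close>
lemma exp_second_order_bound: "\<bar>exp y - 1 - y\<bar> \<le> y\<^sup>2 * exp \<bar>y\<bar>" for y :: real
proof -
  have 1: "0 \<le> exp y - 1 - y" using exp_ge_add_one_self[of y] by linarith
  have "exp y * (1 - y) \<le> exp y * exp (- y)" using exp_ge_add_one_self[of "- y"] by simp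
  then have 2: "exp y - 1 \<le> y * exp y" by (simp add: exp_minus algebra_simps)
  have "exp y - 1 - y \<le> y\<^sup>2 * exp \<bar>y\<bar>"
  proof (cases "y \<ge> 0")
    case True
    have "exp y - 1 - y \<le> y * (exp y - 1)" using 2 by (simp add: algebra_simps)
    also have "\<dots> \<le> y * (y * exp y)" using 2 True by (intro mult_left_mono)
    finally show ?thesis using True by (simp add: power2_eq_square)
  next
    case False
    have "exp y - 1 - y \<le> (- y) * (1 - exp y)" using 2 by (simp add: algebra_simps)
    also have "\<dots> \<le> (- y) * (- y)" using False exp_ge_add_one_self[of y] by (intro mult_left_mono) linarith+
    also have "\<dots> \<le> (- y) * (- y) * exp \<bar>y\<bar>" using False by (simp add: mult_le_cancel_left1)
    finally show ?thesis by (simp add: power2_eq_square)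
  qed
  with 1 show ?thesis by simp
qed

locale half_line_measure = finite_measure M for M :: "real measure" +
  assumes sets_M: "sets M = sets (restrict_space borel {0..})"
begin

lemma space_M: "space M = {0..}"
  using sets_eq_imp_space_eq[OF sets_M] by (simp add: space_restrict_space)

lemma measurable_M [measurable (raw)]:
  assumes "f \<in> borel_measurable borel" shows "f \<in> borel_measurable M"
  using measurable_restrict_space1[OF assms, of "{0..}"] measurable_cong_sets[OF sets_M refl] by blast

definition lap :: "nat \<Rightarrow> real \<Rightarrow> real" where
  "lap n t = (\<integral>x. x ^ n * exp (- t * x) \<partial>M)"

lemma integrable_lap:
  assumes t: "0 < t"
  shows "integrable M (\<lambda>x. x ^ n * exp (- t * x))"
proof (rule integrable_const_bound[where B = "fact n / t ^ n"])
  show "AE x in M. norm (x ^ n * exp (- t * x)) \<le> fact n / t ^ n"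
  proof (rule AE_I2)
    fix x assume "x \<in> space M"
    then have x: "0 \<le> x" by (simp add: space_M)
    have "sum (\<lambda>k. (t * x) ^ k /\<^sub>R fact k) {n} \<le> (\<Sum>k. (t * x) ^ k /\<^sub>R fact k)"
      using x t by (intro sum_le_suminf summable_exp_generic) auto
    then have "(t * x) ^ n / fact n \<le> exp (t * x)"
      by (simp add: exp_def divide_inverse mult.commute)
    then show "norm (x ^ n * exp (- t * x)) \<le> fact n / t ^ n"
      using x t by (simp add: exp_minus divide_simps power_mult_distrib mult_ac)
  qed
qed (rule measurable_M, measurable)

lemma has_real_derivative_lap:
  assumes t: "0 < t"
  shows "(lap n has_real_derivative - lap (Suc n) t) (at t)"
proof -
  define K where "K = lap (n + 2) (t / 2)"
  have key: "\<bar>(lap n (t + h) - lap n t) / h - (- lap (Suc n) t)\<bar> \<le> \<bar>h\<bar> * K" if h: "h \<noteq> 0" "\<bar>h\<bar> < t / 2" for h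
  proof -
    have int: "integrable M (\<lambda>x. x ^ m * exp (- u * x))" if "u > 0" for m u
      using integrable_lap[OF that] .
    have pos: "t + h > 0" "t / 2 > 0" using h t by auto
    have eq: "lap n (t + h) - lap n t + h * lap (Suc n) t
        = (\<integral>x. x ^ n * exp (- (t + h) * x) - x ^ n * exp (- t * x) + h * (x ^ Suc n * exp (- t * x)) \<partial>M)"
    proof -
      have "(\<integral>x. x ^ n * exp (- (t + h) * x) - x ^ n * exp (- t * x) + h * (x ^ Suc n * exp (- t * x)) \<partial>M)
         = (\<integral>x. x ^ n * exp (- (t + h) * x) - x ^ n * exp (- t * x) \<partial>M) + (\<integral>x. h * (x ^ Suc n * exp (- t * x)) \<partial>M)"
        by (intro Bochner_Integration.integral_add Bochner_Integration.integrable_diff integrable_mult_right int pos t)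
      also have "(\<integral>x. x ^ n * exp (- (t + h) * x) - x ^ n * exp (- t * x) \<partial>M) = lap n (t + h) - lap n t"
        unfolding lap_def by (intro Bochner_Integration.integral_diff int pos t)
      also have "(\<integral>x. h * (x ^ Suc n * exp (- t * x)) \<partial>M) = h * lap (Suc n) t"
        unfolding lap_def by (rule integral_mult_right_zero)
      finally show ?thesis by simp
    qed
    have "\<bar>(\<integral>x. x ^ n * exp (- (t + h) * x) - x ^ n * exp (- t * x) + h * (x ^ Suc n * exp (- t * x)) \<partial>M)\<bar>
        \<le> (\<integral>x. h\<^sup>2 * (x ^ (n + 2) * exp (- (t / 2) * x)) \<partial>M)"
    proof (rule order_trans[OF integral_abs_bound], rule integral_mono)
      show "integrable M (\<lambda>x. \<bar>x ^ n * exp (- (t + h) * x) - x ^ n * exp (- t * x) + h * (x ^ Suc n * exp (- t * x))\<bar>)"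
        by (intro integrable_abs Bochner_Integration.integrable_add Bochner_Integration.integrable_diff integrable_mult_right int pos t)
      show "integrable M (\<lambda>x. h\<^sup>2 * (x ^ (n + 2) * exp (- (t / 2) * x)))"
        by (intro integrable_mult_right int pos)
      fix x assume "x \<in> space M"
      then have x: "0 \<le> x" by (simp add: space_M)
      have "x ^ n * exp (- (t + h) * x) - x ^ n * exp (- t * x) + h * (x ^ Suc n * exp (- t * x))
         = x ^ n * exp (- t * x) * (exp (- (h * x)) - 1 - (- (h * x)))"
      proof -
        have "exp (- (t + h) * x) = exp (- t * x) * exp (- (h * x))"
          by (simp flip: exp_add add: algebra_simps)
        then show ?thesis by (simp only: power_Suc) (simp add: algebra_simps)
      qed
      also have "\<bar>\<dots>\<bar> = x ^ n * exp (- t * x) * \<bar>exp (- (h * x)) - 1 - (- (h * x))\<bar>"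
        using x by (simp add: abs_mult)
      also have "\<dots> \<le> x ^ n * exp (- t * x) * ((- (h * x))\<^sup>2 * exp \<bar>- (h * x)\<bar>)"
        using x by (intro mult_left_mono exp_second_order_bound) auto
      also have "\<dots> = h\<^sup>2 * (x ^ (n + 2) * (exp (- t * x) * exp (\<bar>h\<bar> * x)))"
        using x by (simp add: abs_mult power2_eq_square power_add mult_ac)
      also have "exp (- t * x) * exp (\<bar>h\<bar> * x) = exp (- (t - \<bar>h\<bar>) * x)"
        by (simp flip: exp_add add: algebra_simps)
      also have "h\<^sup>2 * (x ^ (n + 2) * exp (- (t - \<bar>h\<bar>) * x)) \<le> h\<^sup>2 * (x ^ (n + 2) * exp (- (t / 2) * x))"
        using x h mult_right_mono[of "\<bar>h\<bar>" "t / 2" x]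
        by (intro mult_left_mono) (auto simp: algebra_simps)
      finally show "\<bar>x ^ n * exp (- (t + h) * x) - x ^ n * exp (- t * x) + h * (x ^ Suc n * exp (- t * x))\<bar>
         \<le> h\<^sup>2 * (x ^ (n + 2) * exp (- (t / 2) * x))" .
    qed
    also have "\<dots> = h\<^sup>2 * K" unfolding K_def lap_def by (rule integral_mult_right_zero)
    finally have le: "\<bar>lap n (t + h) - lap n t + h * lap (Suc n) t\<bar> \<le> h\<^sup>2 * K"
      unfolding eq .
    have "(lap n (t + h) - lap n t) / h - (- lap (Suc n) t) = (lap n (t + h) - lap n t + h * lap (Suc n) t) / h"
      using h(1) by (simp add: add_divide_distrib)
    then have "\<bar>(lap n (t + h) - lap n t) / h - (- lap (Suc n) t)\<bar>
        = \<bar>lap n (t + h) - lap n t + h * lap (Suc n) t\<bar> / \<bar>h\<bar>"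
      by (simp only: abs_divide)
    also have "\<dots> \<le> \<bar>h\<bar> * K"
    proof -
      have "h\<^sup>2 * K = \<bar>h\<bar> * K * \<bar>h\<bar>" by (simp add: power2_eq_square mult_ac)
      with le have "\<bar>lap n (t + h) - lap n t + h * lap (Suc n) t\<bar> \<le> \<bar>h\<bar> * K * \<bar>h\<bar>" by (simp only:)
      moreover have "0 < \<bar>h\<bar>" using h(1) by simp
      ultimately show ?thesis by (simp only: pos_divide_le_eq)
    qed
    finally show ?thesis .
  qed
  have "((\<lambda>h. (lap n (t + h) - lap n t) / h - (- lap (Suc n) t)) \<longlongrightarrow> 0) (at 0)"
  proof (rule Lim_null_comparison)
    show "eventually (\<lambda>h. norm ((lap n (t + h) - lap n t) / h - (- lap (Suc n) t)) \<le> \<bar>h\<bar> * K) (at 0)"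
      unfolding eventually_at using key t by (intro exI[of _ "t / 2"]) auto
    show "((\<lambda>h. \<bar>h\<bar> * K) \<longlongrightarrow> 0) (at 0)" by (auto intro!: tendsto_eq_intros)
  qed
  then show ?thesis unfolding DERIV_def by (rule LIM_zero_cancel)
qed

lemma funpow_deriv_laplace:
  assumes phi: "\<And>t. 0 < t \<Longrightarrow> \<phi> t = (\<integral>x. exp (- t * x) \<partial>M)" and "0 < t"
  shows "(deriv ^^ n) \<phi> t = (- 1) ^ n * lap n t"
  using \<open>0 < t\<close>
proof (induction n arbitrary: t)
  case 0
  then show ?case using phi by (simp add: lap_def)
next
  case (Suc n)
  have "((\<lambda>t. (- 1) ^ n * lap n t) has_real_derivative (- 1) ^ n * (- lap (Suc n) t)) (at t)"
    by (intro DERIV_cmult has_real_derivative_lap Suc.prems)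
  then have "((deriv ^^ n) \<phi> has_real_derivative (- 1) ^ n * (- lap (Suc n) t)) (at t)"
    by (rule has_field_derivative_transform_within_open[of _ _ _ "{0<..}"]) (use Suc in auto)
  then show ?case by (simp add: DERIV_imp_deriv)
qed

lemma taylor_seq_laplace:
  assumes phi: "\<And>t. 0 < t \<Longrightarrow> \<phi> t = (\<integral>x. exp (- t * x) \<partial>M)" and t: "0 < t"
  shows "0 \<le> taylor_seq \<phi> t n"
    and "ennreal (taylor_seq \<phi> t n) = (\<integral>\<^sup>+x. ennreal (x ^ n / fact n * exp (- t * x)) \<partial>M)"
proof -
  have "taylor_seq \<phi> t n = lap n t / fact n"
    using funpow_deriv_laplace[OF phi t, of n] by (simp add: taylor_seq_def flip: power_mult_distrib)
  also have "\<dots> = (\<integral>x. x ^ n / fact n * exp (- t * x) \<partial>M)"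
    by (simp add: lap_def flip: integral_divide_zero)
  finally have eq: "taylor_seq \<phi> t n = (\<integral>x. x ^ n / fact n * exp (- t * x) \<partial>M)" .
  have nn: "AE x in M. 0 \<le> x ^ n / fact n * exp (- t * x)"
    by (rule AE_I2) (simp add: space_M)
  have "integrable M (\<lambda>x. x ^ n / fact n * exp (- t * x))"
    using integrable_divide[OF integrable_lap[OF t, of n], of "fact n"] by simp
  with nn show "ennreal (taylor_seq \<phi> t n) = (\<integral>\<^sup>+x. ennreal (x ^ n / fact n * exp (- t * x)) \<partial>M)"
    unfolding eq by (intro nn_integral_eq_integral[symmetric])
  show "0 \<le> taylor_seq \<phi> t n" unfolding eq using nn by (rule integral_nonneg_AE)
qed

end

section \<open>Log-concave measures have log-concave Taylor sequences\<close>

lemma pf2_seq_dirac: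
  assumes "0 \<le> c" "0 \<le> x"
  shows "pf2_seq (\<lambda>n. c * (x ^ n / fact n))"
  unfolding pf2_seq_def
proof (intro conjI allI impI)
  fix i j :: nat assume ij: "i \<le> j"
  have "(fact (Suc i) :: real) * fact j \<le> fact i * fact (Suc j)"
    using ij by (simp add: mult_ac)
  then have "x ^ (i + Suc j) / (fact i * fact (Suc j)) \<le> x ^ (i + Suc j) / (fact (Suc i) * fact j)"
    using assms by (intro divide_left_mono) auto
  then have "c * c * (x ^ (i + Suc j) / (fact i * fact (Suc j))) \<le> c * c * (x ^ (i + Suc j) / (fact (Suc i) * fact j))"
    by (intro mult_left_mono) auto
  then show "c * (x ^ i / fact i) * (c * (x ^ Suc j / fact (Suc j)))
      \<le> c * (x ^ Suc i / fact (Suc i)) * (c * (x ^ j / fact j))"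
    by (simp add: power_add mult_ac del: fact_Suc)
qed (use assms in auto)

text \<open>
  Vanishing of one moment means that the density is zero almost everywhere on the half-line, so
  the sequence of moments is either positive or identically zero. Hence neighbouring indices
  suffice to obtain all the two-by-two minors.
\<close>
lemma moment_eq_0_imp:
  assumes [measurable]: "f \<in> borel_measurable borel" and "moment n f = 0"
  shows "moment m f = 0"
proof -
  have [simp]: "\<not> fact k \<le> (0::real)" for k by (simp add: not_le)
  have "AE x in lborel. (if 0 \<le> x then ennreal (x ^ n / fact n) * f x else 0) = 0"
    using assms(2) unfolding moment_def by (subst (asm) nn_integral_0_iff_AE) auto
  then have "AE x in lborel. (if 0 \<le> x then ennreal (x ^ m / fact m) * f x else 0) = 0"
    using AE_lborel_singleton[of 0] by eventually_elim (auto split: if_splits simp: ennreal_eq_0_iff divide_le_0_iff power_le_zero_eq)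
  then show ?thesis unfolding moment_def by (subst nn_integral_0_iff_AE) auto
qed

lemma pf2_seq_of_moments:
  assumes f: "f \<in> borel_measurable borel" "cross_ineq f"
    and a: "\<And>n. 0 \<le> a n" "\<And>n. ennreal (a n) = moment n f"
  shows "pf2_seq a"
proof (cases "\<exists>n. a n = 0")
  case True
  then obtain n where "moment n f = 0" using a(2) by (metis ennreal_0)
  then have "a m = 0" for m using moment_eq_0_imp[OF f(1), of n m] a[of m] by (metis ennreal_eq_0_iff antisym)
  then show ?thesis by (simp add: pf2_seq_def)
next
  case False
  then have pos: "0 < a n" for n using a(1)[of n] by (auto simp: less_le)
  have "ennreal (a n * a (Suc (Suc n))) \<le> ennreal (a (Suc n) * a (Suc n))" for n
    using moment_log_concave[OF f, of n] a by (simp add: ennreal_mult)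
  then have "a n * a (Suc (Suc n)) \<le> a (Suc n) * a (Suc n)" for n
    using a(1) by (subst (asm) ennreal_le_iff) auto
  then show ?thesis by (rule pf2_seq_of_pos[OF pos])
qed

text \<open>
  In the absolutely continuous case the density is extended by zero, so that it is Borel
  measurable on the whole line and the exponential factor can be absorbed into it.
\<close>
theorem log_concave_seq_taylor_of_log_concave_measure:
  fixes \<mu> :: "real measure"
  assumes s: "sets \<mu> = sets (restrict_space borel {0..})" and fin: "finite_measure \<mu>"
    and lc: "log_concave_measure \<mu>"
    and phi: "\<And>t. 0 \<le> t \<Longrightarrow> \<phi> t = (\<integral>x. exp (- t * x) \<partial>\<mu>)" and t: "0 < t"
  shows "log_concave_seq (taylor_seq \<phi> t)"
proof (rule pf2_seq_imp_log_concave_seq)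
  interpret half_line_measure \<mu>
    using fin s by (simp add: half_line_measure_def half_line_measure_axioms_def)
  have phi': "\<phi> t = (\<integral>x. exp (- t * x) \<partial>\<mu>)" if "0 < t" for t using phi that by simp
  note a = taylor_seq_laplace[OF phi' t]
  from lc[unfolded log_concave_measure_def] show "pf2_seq (taylor_seq \<phi> t)"
  proof
    assume "\<exists>c x0. 0 \<le> c \<and> 0 \<le> x0 \<and> \<mu> = scale_measure (ennreal c) (return (restrict_space borel {0..}) x0)"
    then obtain c x0 where c: "0 \<le> c" "0 \<le> x0" and mu: "\<mu> = scale_measure (ennreal c) (return (restrict_space borel {0..}) x0)" by blast
    have "taylor_seq \<phi> t n = (c * exp (- t * x0)) * (x0 ^ n / fact n)" for n
    proof -
      have m: "(\<lambda>x::real. ennreal (x ^ n / fact n * exp (- t * x))) \<in> borel_measurable (restrict_space borel {0..})"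
        by (intro measurable_restrict_space1) measurable
      have "ennreal (taylor_seq \<phi> t n) = (\<integral>\<^sup>+x. ennreal (x ^ n / fact n * exp (- t * x)) \<partial>\<mu>)"
        by (rule a(2))
      also have "\<dots> = ennreal c * (\<integral>\<^sup>+x. ennreal (x ^ n / fact n * exp (- t * x)) \<partial>return (restrict_space borel {0..}) x0)"
        unfolding mu using m by (intro nn_integral_scale_measure) simp
      also have "(\<integral>\<^sup>+x. ennreal (x ^ n / fact n * exp (- t * x)) \<partial>return (restrict_space borel {0..}) x0)
          = ennreal (x0 ^ n / fact n * exp (- t * x0))"
        using c m by (intro nn_integral_return) (auto simp: space_restrict_space)
      also have "ennreal c * ennreal (x0 ^ n / fact n * exp (- t * x0)) = ennreal ((c * exp (- t * x0)) * (x0 ^ n / fact n))"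
        using c by (subst ennreal_mult[symmetric]) (auto simp: mult_ac)
      finally show ?thesis using a(1) c by (subst (asm) ennreal_inj) auto
    qed
    then have "taylor_seq \<phi> t = (\<lambda>n. (c * exp (- t * x0)) * (x0 ^ n / fact n))" by auto
    then show ?thesis using pf2_seq_dirac[of "c * exp (- t * x0)" x0] c by simp
  next
    assume "\<exists>f. f \<in> borel_measurable (restrict_space borel {0..}) \<and> log_concave_on {0..} f \<and>
        \<mu> = density (restrict_space lborel {0..}) (\<lambda>x. ennreal (f x))"
    then obtain f where f: "f \<in> borel_measurable (restrict_space borel {0..})" "log_concave_on {0..} f"
      and mu: "\<mu> = density (restrict_space lborel {0..}) (\<lambda>x. ennreal (f x))" by blast
    define g where "g x = (if 0 \<le> x then f x else 0)" for x
    have g[measurable]: "g \<in> borel_measurable borel"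
    proof -
      have "(\<lambda>x. if x \<in> {0..} then f x else 0) \<in> borel_measurable borel"
        using f(1) by (subst measurable_restrict_space_iff[symmetric]) auto
      then show ?thesis by (simp add: g_def[abs_def])
    qed
    have glc: "log_concave_on {0..} g"
      using f(2) by (auto simp: log_concave_on_def g_def)
    have m: "(\<lambda>x. ennreal (g x * exp (- t * x))) \<in> borel_measurable borel" by measurable
    have nn: "0 \<le> f x" if "0 \<le> x" for x using f(2) that by (auto simp: log_concave_on_def)
    have "ennreal (taylor_seq \<phi> t n) = moment n (\<lambda>x. ennreal (g x * exp (- t * x)))" for n
    proof -
      have fm: "(\<lambda>x. ennreal (f x)) \<in> borel_measurable (restrict_space lborel {0..})"
      proof -
        have "sets (restrict_space lborel {0::real..}) = sets (restrict_space borel {0..})"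
          by (intro sets_restrict_space_cong) simp
        then have "f \<in> borel_measurable (restrict_space lborel {0..})"
          using f(1) measurable_cong_sets by blast
        then show ?thesis by (rule measurable_compose[OF _ measurable_ennreal])
      qed
      have xm: "(\<lambda>x::real. ennreal (x ^ n / fact n * exp (- t * x))) \<in> borel_measurable (restrict_space lborel {0..})"
        by (intro measurable_restrict_space1) measurable
      have "ennreal (taylor_seq \<phi> t n) = (\<integral>\<^sup>+x. ennreal (x ^ n / fact n * exp (- t * x)) \<partial>\<mu>)"
        by (rule a(2))
      also have "\<dots> = (\<integral>\<^sup>+x. ennreal (f x) * ennreal (x ^ n / fact n * exp (- t * x)) \<partial>restrict_space lborel {0..})"
        unfolding mu using fm xm by (rule nn_integral_density)
      also have "\<dots> = (\<integral>\<^sup>+x. ennreal (f x) * ennreal (x ^ n / fact n * exp (- t * x)) * indicator {0..} x \<partial>lborel)"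
        by (rule nn_integral_restrict_space) simp
      also have "\<dots> = moment n (\<lambda>x. ennreal (g x * exp (- t * x)))"
        unfolding moment_def using nn
        by (intro nn_integral_cong) (auto simp: g_def mult_ac simp flip: ennreal_mult split: split_indicator)
      finally show ?thesis .
    qed
    then show ?thesis using pf2_seq_of_moments[OF m log_concave_on_imp_cross_ineq[OF glc] a(1)] by simp
  qed
qed

section \<open>Taylor series of completely monotone functions\<close>

text \<open>
  The function \<open>b n\<close> plays the role of the n-th derivative of \<open>b 0\<close> up to the sign \<open>(-1)\<^sup>n\<close>. Treating the whole
  family at once makes the estimates below uniform in the order of the derivative, as needed for
  induction.
\<close>
locale completely_monotone_family =
  fixes b :: "nat \<Rightarrow> real \<Rightarrow> real"
  assumes nonneg: "0 < t \<Longrightarrow> 0 \<le> b n t"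
    and deriv_b: "0 < t \<Longrightarrow> (b n has_real_derivative - b (Suc n) t) (at t)"
begin

definition taylor_rem :: "nat \<Rightarrow> nat \<Rightarrow> real \<Rightarrow> real \<Rightarrow> real" where
  "taylor_rem n k t s = b k s - (\<Sum>j<n. b (k + j) t * (t - s) ^ j / fact j)"

lemma taylor_rem_0: "taylor_rem 0 k t s = b k s"
  by (simp add: taylor_rem_def)

lemma taylor_rem_endpoint: "taylor_rem (Suc n) k t t = 0"
  unfolding taylor_rem_def by (subst sum.lessThan_Suc_shift) simp

text \<open>
  The truncated subtraction is deliberate: for \<open>n = 0\<close> the remainder is the function itself, and the
  same formula holds.
\<close>
lemma has_real_derivative_taylor_rem:
  assumes "0 < s"
  shows "(taylor_rem n k t has_real_derivative - taylor_rem (n - 1) (Suc k) t s) (at s)"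
proof (cases n)
  case 0
  then show ?thesis using deriv_b[OF assms] by (simp add: taylor_rem_0[abs_def])
next
  case (Suc m)
  have eq: "taylor_rem (Suc m) k t = (\<lambda>s. b k s - b k t - (\<Sum>j<m. b (Suc k + j) t * (t - s) ^ Suc j / fact (Suc j)))"
    unfolding taylor_rem_def by (rule ext, subst sum.lessThan_Suc_shift) simp
  have "((\<lambda>s. b (Suc k + j) t * (t - s) ^ Suc j / fact (Suc j)) has_real_derivative
     - (b (Suc k + j) t * (t - s) ^ j / fact j)) (at s)" for j
  proof -
    have "((\<lambda>s. b (Suc k + j) t * (t - s) ^ Suc j / fact (Suc j)) has_real_derivative
       b (Suc k + j) t * (real (Suc j) * (t - s) ^ j * (- 1)) / fact (Suc j)) (at s)"
      by (auto intro!: derivative_eq_intros simp del: power_Suc fact_Suc of_nat_Suc)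
    also have "b (Suc k + j) t * (real (Suc j) * (t - s) ^ j * (- 1)) / fact (Suc j) = - (b (Suc k + j) t * (t - s) ^ j / fact j)"
      by (simp add: divide_simps del: of_nat_Suc)
    finally show ?thesis .
  qed
  then have "(taylor_rem (Suc m) k t has_real_derivative
     - b (Suc k) s - 0 - (\<Sum>j<m. - (b (Suc k + j) t * (t - s) ^ j / fact j))) (at s)"
    unfolding eq by (intro DERIV_diff DERIV_sum DERIV_const deriv_b assms) auto
  then show ?thesis using Suc by (simp add: taylor_rem_def sum_negf)
qed

lemma nonneg_of_deriv_nonpos:
  assumes "0 < s" "s \<le> t" "F t = 0"
    and "\<And>u. 0 < u \<Longrightarrow> u \<le> t \<Longrightarrow> (F has_real_derivative F' u) (at u)"
    and "\<And>u. 0 < u \<Longrightarrow> u \<le> t \<Longrightarrow> F' u \<le> 0"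
  shows "0 \<le> F s"
proof -
  have "F t \<le> F s"
  proof (rule DERIV_nonpos_imp_nonincreasing[OF assms(2)])
    fix u assume "s \<le> u" "u \<le> t"
    then have "0 < u" using assms(1) by simp
    then show "\<exists>y. (F has_real_derivative y) (at u) \<and> y \<le> 0" using assms(4,5) \<open>u \<le> t\<close> by blast
  qed
  then show ?thesis using assms(3) by simp
qed

lemma taylor_rem_nonneg:
  assumes "0 < s" "s \<le> t"
  shows "0 \<le> taylor_rem n k t s"
  using assms
proof (induction n arbitrary: k s)
  case 0
  then show ?case by (simp add: taylor_rem_0 nonneg)
next
  case (Suc n)
  show ?case
    using Suc has_real_derivative_taylor_rem[of _ "Suc n" k t]
    by (intro nonneg_of_deriv_nonpos[where F = "taylor_rem (Suc n) k t" and F' = "\<lambda>u. - taylor_rem n (Suc k) t u", OF Suc.prems taylor_rem_endpoint]) auto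
qed

text \<open>
  The heart of Bernstein's argument: this inequality says that \<open>taylor_rem n k t s / (t - s)\<^sup>n\<close> decreases in \<open>s\<close>. The
  difference of the two sides vanishes at \<open>t\<close>, and its derivative is minus the same difference for
  \<open>n - 1\<close> and \<open>k + 1\<close>.
\<close>
lemma taylor_rem_deriv_lower:
  assumes "0 < s" "s \<le> t"
  shows "real n * taylor_rem n k t s \<le> (t - s) * taylor_rem (n - 1) (Suc k) t s"
  using assms
proof (induction n arbitrary: k s)
  case 0
  then show ?case by (simp add: taylor_rem_0 nonneg)
next
  case (Suc n)
  define F where "F s = (t - s) * taylor_rem n (Suc k) t s - real (Suc n) * taylor_rem (Suc n) k t s" for s
  define F' where "F' s = real n * taylor_rem n (Suc k) t s - (t - s) * taylor_rem (n - 1) (Suc (Suc k)) t s" for s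
  have "0 \<le> F s"
  proof (rule nonneg_of_deriv_nonpos[OF Suc.prems])
    show "F t = 0" by (simp add: F_def taylor_rem_endpoint)
    fix u assume u: "0 < u" "u \<le> t"
    have "(F has_real_derivative ((t - u) * (- taylor_rem (n - 1) (Suc (Suc k)) t u) + (0 - 1) * taylor_rem n (Suc k) t u)
        - real (Suc n) * (- taylor_rem (Suc n - 1) (Suc k) t u)) (at u)"
      unfolding F_def
      by (intro DERIV_diff DERIV_mult' DERIV_cmult has_real_derivative_taylor_rem u DERIV_const DERIV_ident)
    then show "(F has_real_derivative F' u) (at u)" by (simp add: F'_def algebra_simps)
    show "F' u \<le> 0" using Suc.IH[OF u, of "Suc k"] by (simp add: F'_def)
  qed
  then show ?case by (simp add: F_def)
qed

text \<open>
  By monotonicity of the normalised remainder, its value at \<open>s\<close> is at most the one at \<open>r < s\<close>, where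
  the remainder is trivially bounded by the function.
\<close>
lemma taylor_rem_geometric:
  assumes rs: "0 < r" "r \<le> s" "s < t"
  shows "taylor_rem n k t s \<le> b k r * ((t - s) / (t - r)) ^ n"
proof -
  define F where "F s = taylor_rem n k t s * inverse (t - s) ^ n" for s
  have "F s \<le> F r"
  proof (rule DERIV_nonpos_imp_nonincreasing[OF rs(2)])
    fix u assume u: "r \<le> u" "u \<le> s"
    then have u': "0 < u" "u < t" using rs by auto
    have "((\<lambda>u. inverse (t - u) ^ n) has_real_derivative real n * inverse (t - u) ^ Suc n) (at u)"
    proof -
      have "((\<lambda>u. inverse (t - u)) has_real_derivative inverse (t - u) ^ 2) (at u)"
        using u' by (auto intro!: derivative_eq_intros simp: power2_eq_square)
      from DERIV_power[OF this, of n] show ?thesis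
        by (cases n) (simp_all add: power2_eq_square mult_ac)
    qed
    then have "(F has_real_derivative taylor_rem n k t u * (real n * inverse (t - u) ^ Suc n) + (- taylor_rem (n - 1) (Suc k) t u) * inverse (t - u) ^ n) (at u)"
      unfolding F_def by (intro DERIV_mult' has_real_derivative_taylor_rem u')
    moreover have "taylor_rem n k t u * (real n * inverse (t - u) ^ Suc n) + (- taylor_rem (n - 1) (Suc k) t u) * inverse (t - u) ^ n
       = inverse (t - u) ^ Suc n * (real n * taylor_rem n k t u - (t - u) * taylor_rem (n - 1) (Suc k) t u)"
    proof -
      have "inverse (t - u) ^ n = inverse (t - u) ^ Suc n * (t - u)" using u' by simp
      then have "taylor_rem n k t u * (real n * inverse (t - u) ^ Suc n) + (- taylor_rem (n - 1) (Suc k) t u) * inverse (t - u) ^ n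
         = taylor_rem n k t u * (real n * inverse (t - u) ^ Suc n)
           + (- taylor_rem (n - 1) (Suc k) t u) * (inverse (t - u) ^ Suc n * (t - u))" by metis
      also have "\<dots> = inverse (t - u) ^ Suc n * (real n * taylor_rem n k t u - (t - u) * taylor_rem (n - 1) (Suc k) t u)"
      proof -
        have "R * (m * J) + (- S) * (J * d) = J * (m * R - d * S)" for R m J S d :: real
          by (simp add: algebra_simps)
        then show ?thesis .
      qed
      finally show ?thesis .
    qed
    moreover have "\<dots> \<le> 0"
      using taylor_rem_deriv_lower[of u t n k] u' by (intro mult_nonneg_nonpos) auto
    ultimately show "\<exists>y. (F has_real_derivative y) (at u) \<and> y \<le> 0" by auto
  qed
  also have "F r \<le> b k r * inverse (t - r) ^ n"
  proof -
    have "taylor_rem n k t r \<le> b k r"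
      unfolding taylor_rem_def using rs by (auto intro!: sum_nonneg divide_nonneg_nonneg mult_nonneg_nonneg nonneg)
    then show ?thesis unfolding F_def using rs by (intro mult_right_mono) auto
  qed
  finally have "taylor_rem n k t s * inverse (t - s) ^ n * (t - s) ^ n \<le> b k r * inverse (t - r) ^ n * (t - s) ^ n"
    unfolding F_def using rs by (intro mult_right_mono) auto
  then show ?thesis using rs by (simp add: power_divide field_simps)
qed

theorem taylor_sums:
  assumes "0 < s" "s \<le> t"
  shows "(\<lambda>j. b (k + j) t * (t - s) ^ j / fact j) sums b k s"
proof (cases "s = t")
  case True
  have "(\<lambda>j. b (k + j) t * (t - s) ^ j / fact j) sums (\<Sum>j\<in>{0}. b (k + j) t * (t - s) ^ j / fact j)"
    using True by (intro sums_finite) auto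
  then show ?thesis using True by simp
next
  case False
  define r where "r = s / 2"
  have r: "0 < r" "r \<le> s" "s < t" using assms False by (auto simp: r_def)
  have q: "\<bar>(t - s) / (t - r)\<bar> < 1" using r assms by (auto simp: r_def)
  have "(\<lambda>n. taylor_rem n k t s) \<longlonglongrightarrow> 0"
  proof (rule tendsto_sandwich[of "\<lambda>_. 0"])
    show "\<forall>\<^sub>F n in sequentially. 0 \<le> taylor_rem n k t s" using taylor_rem_nonneg assms by simp
    show "\<forall>\<^sub>F n in sequentially. taylor_rem n k t s \<le> b k r * ((t - s) / (t - r)) ^ n" using taylor_rem_geometric[OF r] by simp
    show "(\<lambda>n. b k r * ((t - s) / (t - r)) ^ n) \<longlonglongrightarrow> 0"
      using q by (intro tendsto_mult_right_zero LIMSEQ_abs_realpow_zero2)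
  qed simp
  then have "(\<lambda>n. b k s - taylor_rem n k t s) \<longlonglongrightarrow> b k s - 0" by (intro tendsto_intros)
  then show ?thesis by (simp add: sums_def taylor_rem_def)
qed

end

section \<open>Gamma mixtures with log-concave weights\<close>

text \<open>
  The operator \<open>1 + e * Shift\<close>; its powers with \<open>e = x / m\<close> approximate \<open>exp (x * Shift)\<close>.
\<close>
definition shift_mix :: "real \<Rightarrow> (nat \<Rightarrow> real) \<Rightarrow> nat \<Rightarrow> real" where
  "shift_mix e p = (\<lambda>k. p k + e * p (Suc k))"

text \<open>
  Expand in powers of \<open>e\<close>: the constant and quadratic coefficients are minors of \<open>p\<close>, and in the linear
  coefficient two of the four products cancel.
\<close>
lemma pf2_seq_shift_mix:
  assumes p: "pf2_seq p" and e: "0 \<le> e"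
  shows "pf2_seq (shift_mix e p)"
  unfolding pf2_seq_def
proof (intro conjI allI impI)
  note nn = pf2_seqD(1)[OF p] and st = pf2_seqD(2)[OF p]
  show "0 \<le> shift_mix e p n" for n using nn e by (simp add: shift_mix_def)
  fix i j :: nat assume ij: "i \<le> j"
  have "p i * p (Suc (Suc j)) \<le> p (Suc (Suc i)) * p j"
  proof (cases "i = j")
    case False
    then show ?thesis using st[of i "Suc j"] st[of "Suc i" j] ij by simp
  qed (simp add: mult.commute)
  then have "e * (p i * p (Suc (Suc j))) \<le> e * (p (Suc (Suc i)) * p j)"
    using e by (rule mult_left_mono)
  moreover have "p i * p (Suc j) \<le> p (Suc i) * p j" using st ij by simp
  moreover have "e * e * (p (Suc i) * p (Suc (Suc j))) \<le> e * e * (p (Suc (Suc i)) * p (Suc j))"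
    using st[of "Suc i" "Suc j"] ij e by (intro mult_left_mono) auto
  ultimately show "shift_mix e p i * shift_mix e p (Suc j) \<le> shift_mix e p (Suc i) * shift_mix e p j"
    unfolding shift_mix_def by (simp add: algebra_simps)
qed

lemma shift_mix_funpow:
  "(shift_mix e ^^ m) p k = (\<Sum>n\<le>m. real (m choose n) * e ^ n * p (k + n))"
proof (induction m arbitrary: k)
  case (Suc m)
  have "(shift_mix e ^^ Suc m) p k
      = (\<Sum>n\<le>m. real (m choose n) * e ^ n * p (k + n)) + e * (\<Sum>n\<le>m. real (m choose n) * e ^ n * p (Suc k + n))"
    by (simp add: shift_mix_def[of _ "(shift_mix e ^^ m) p"] Suc.IH)
  also have "e * (\<Sum>n\<le>m. real (m choose n) * e ^ n * p (Suc k + n))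
     = (\<Sum>n\<le>m. real (m choose n) * e ^ Suc n * p (k + Suc n))"
    by (simp add: sum_distrib_left mult_ac)
  also have "(\<Sum>n\<le>m. real (m choose n) * e ^ n * p (k + n))
     = p k + (\<Sum>n\<le>m. real (m choose Suc n) * e ^ Suc n * p (k + Suc n))"
  proof -
    have "(\<Sum>n\<le>m. real (m choose n) * e ^ n * p (k + n)) = (\<Sum>n\<le>Suc m. real (m choose n) * e ^ n * p (k + n))"
      by simp
    also have "\<dots> = p k + (\<Sum>n\<le>m. real (m choose Suc n) * e ^ Suc n * p (k + Suc n))"
      by (subst sum.atMost_Suc_shift) simp
    finally show ?thesis .
  qed
  also have "p k + (\<Sum>n\<le>m. real (m choose Suc n) * e ^ Suc n * p (k + Suc n))
       + (\<Sum>n\<le>m. real (m choose n) * e ^ Suc n * p (k + Suc n))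
     = p k + (\<Sum>n\<le>m. real (Suc m choose Suc n) * e ^ Suc n * p (k + Suc n))"
    by (simp add: sum.distrib[symmetric] algebra_simps)
  also have "\<dots> = (\<Sum>n\<le>Suc m. real (Suc m choose n) * e ^ n * p (k + n))"
    using sum.atMost_Suc_shift[of "\<lambda>n. real (Suc m choose n) * e ^ n * p (k + n)" m] by simp
  finally show ?case .
qed simp

text \<open>
  On the open half-line \<open>- ln u\<close> is convex by its second derivative. The function may vanish at 0, so
  the endpoint is reached by shifting both arguments to the right and letting the shift tend to 0.
\<close>
lemma log_concave_on_half_line_of_derivs:
  fixes u u1 u2 :: "real \<Rightarrow> real"
  assumes d1: "\<And>x. (u has_real_derivative u1 x) (at x)"
    and d2: "\<And>x. (u1 has_real_derivative u2 x) (at x)"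
    and pos: "\<And>x. 0 < x \<Longrightarrow> 0 < u x"
    and le: "\<And>x. 0 < x \<Longrightarrow> u x * u2 x \<le> u1 x * u1 x"
    and nn: "0 \<le> u 0"
  shows "log_concave_on {0..} u"
proof -
  have cv: "convex_on {0<..} (\<lambda>x. - ln (u x))"
  proof (rule f''_ge0_imp_convex)
    fix x :: real assume "x \<in> {0<..}"
    then have x: "0 < u x" using pos by simp
    show "((\<lambda>x. - ln (u x)) has_real_derivative - (u1 x / u x)) (at x)"
      using x by (auto intro!: derivative_eq_intros d1)
    show "((\<lambda>x. - (u1 x / u x)) has_real_derivative (u1 x * u1 x - u x * u2 x) / (u x * u x)) (at x)"
      using x by (auto intro!: derivative_eq_intros d1 d2 simp: field_simps)
    show "0 \<le> (u1 x * u1 x - u x * u2 x) / (u x * u x)"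
      using le[of x] \<open>x \<in> {0<..}\<close> by simp
  qed simp
  have cvx: "- ln (u (l * x + (1 - l) * y)) \<le> l * - ln (u x) + (1 - l) * - ln (u y)"
    if "0 < x" "0 < y" "l \<in> {0<..<1}" for x y l
  proof -
    have "- ln (u (l *\<^sub>R x + (1 - l) *\<^sub>R y)) \<le> l * - ln (u x) + (1 - l) * - ln (u y)"
    proof -
      have "- ln (u ((1 - (1 - l)) *\<^sub>R x + (1 - l) *\<^sub>R y)) \<le> (1 - (1 - l)) * - ln (u x) + (1 - l) * - ln (u y)"
        using that by (intro convex_onD[OF cv]) auto
      moreover have "1 - (1 - l) = l" by simp
      ultimately show ?thesis by (simp only:)
    qed
    then show ?thesis by (simp only: real_scaleR_def)
  qed
  have interior: "u x powr l * u y powr (1 - l) \<le> u (l * x + (1 - l) * y)"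
    if "0 < x" "0 < y" "l \<in> {0<..<1}" for x y l
  proof -
    define z where "z = l * x + (1 - l) * y"
    have "0 < z" using that by (simp add: z_def add_pos_pos)
    then have up: "0 < u x" "0 < u y" "0 < u z" using pos that by blast+
    have "- ln (u z) \<le> l * - ln (u x) + (1 - l) * - ln (u y)" using cvx[OF that] by (simp only: z_def)
    then have "l * ln (u x) + (1 - l) * ln (u y) \<le> ln (u z)" by linarith
    then have "exp (l * ln (u x) + (1 - l) * ln (u y)) \<le> u z" using up by (simp only: ln_ge_iff)
    then show ?thesis using up by (simp only: powr_def exp_add z_def) simp
  qed
  have nn': "0 \<le> u x" if "0 \<le> x" for x using nn pos[of x] that by (cases "x = 0") auto
  have lim: "((\<lambda>e. u (x + e)) \<longlongrightarrow> u x) (at_right 0)" for x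
  proof (rule isCont_tendsto_compose[OF DERIV_isCont[OF d1]])
    have "((\<lambda>e. x + e) \<longlongrightarrow> x + 0) (at_right 0)" by (intro tendsto_intros)
    then show "((\<lambda>e. x + e) \<longlongrightarrow> x) (at_right 0)" by simp
  qed
  have "u x powr l * u y powr (1 - l) \<le> u (l * x + (1 - l) * y)"
    if xy: "0 \<le> x" "0 \<le> y" and l: "l \<in> {0<..<1}" for x y l
  proof (rule tendsto_le)
    show "((\<lambda>e. u ((l * x + (1 - l) * y) + e)) \<longlongrightarrow> u (l * x + (1 - l) * y)) (at_right 0)" by (rule lim)
    have "eventually (\<lambda>e::real. e > 0) (at_right 0)" by (simp add: eventually_at_right_less)
    then have ev: "eventually (\<lambda>e. 0 \<le> u (z + e)) (at_right 0)" if "0 \<le> z" for z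
      by eventually_elim (use that nn' in auto)
    show "((\<lambda>e. u (x + e) powr l * u (y + e) powr (1 - l)) \<longlongrightarrow> u x powr l * u y powr (1 - l)) (at_right 0)"
      using l xy by (intro tendsto_mult tendsto_powr2 lim tendsto_const ev) auto
    have "eventually (\<lambda>e::real. e > 0) (at_right 0)" by (simp add: eventually_at_right_less)
    then show "eventually (\<lambda>e. u (x + e) powr l * u (y + e) powr (1 - l) \<le> u ((l * x + (1 - l) * y) + e)) (at_right 0)"
    proof eventually_elim
      case (elim e)
      then show ?case using interior[of "x + e" "y + e" l] xy l by (simp add: algebra_simps)
    qed
  qed simp
  then show ?thesis using nn' by (auto simp: log_concave_on_def)
qed

lemma log_concave_on_exp_scale:
  assumes h: "log_concave_on {0..} h" and "0 \<le> c" "0 \<le> e"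
  shows "log_concave_on {0..} (\<lambda>x. c * exp (d * x) * h (e * x))"
  unfolding log_concave_on_def
proof (intro conjI ballI)
  have nn: "0 \<le> h x" if "0 \<le> x" for x using h that by (auto simp: log_concave_on_def)
  show "0 \<le> c * exp (d * x) * h (e * x)" if "x \<in> {0..}" for x using assms nn that by simp
  fix x y l :: real assume xy: "x \<in> {0..}" "y \<in> {0..}" and l: "l \<in> {0<..<1}"
  have ex: "exp (d * x) powr l * exp (d * y) powr (1 - l) = exp (d * (l * x + (1 - l) * y))"
    by (simp add: powr_def exp_add[symmetric] algebra_simps)
  have cc: "c powr l * c powr (1 - l) = c" using assms by (cases "c = 0") (auto simp flip: powr_add)
  have hh: "h (e * x) powr l * h (e * y) powr (1 - l) \<le> h (l *\<^sub>R (e * x) + (1 - l) *\<^sub>R (e * y))"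
    using h xy l assms(3) unfolding log_concave_on_def by (auto simp del: real_scaleR_def)
  have "(c * exp (d * x) * h (e * x)) powr l * (c * exp (d * y) * h (e * y)) powr (1 - l)
    = (c powr l * c powr (1 - l)) * (exp (d * x) powr l * exp (d * y) powr (1 - l)) * (h (e * x) powr l * h (e * y) powr (1 - l))"
    using assms xy nn by (simp add: powr_mult mult_ac)
  also have "\<dots> = c * exp (d * (l * x + (1 - l) * y)) * (h (e * x) powr l * h (e * y) powr (1 - l))"
    by (simp only: ex cc)
  also have "\<dots> \<le> c * exp (d * (l * x + (1 - l) * y)) * h (l *\<^sub>R (e * x) + (1 - l) *\<^sub>R (e * y))"
    using hh assms by (intro mult_left_mono) auto
  also have "l *\<^sub>R (e * x) + (1 - l) *\<^sub>R (e * y) = e * (l *\<^sub>R x + (1 - l) *\<^sub>R y)"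
    by (simp add: algebra_simps)
  finally show "(c * exp (d * x) * h (e * x)) powr l * (c * exp (d * y) * h (e * y)) powr (1 - l)
     \<le> c * exp (d * (l *\<^sub>R x + (1 - l) *\<^sub>R y)) * h (e * (l *\<^sub>R x + (1 - l) *\<^sub>R y))"
    by simp
qed simp

definition egf :: "(nat \<Rightarrow> real) \<Rightarrow> real \<Rightarrow> real" where
  "egf p x = (\<Sum>n. p n / fact n * x ^ n)"

lemma egf_0: "egf p 0 = p 0"
  using powser_zero[of "\<lambda>n. p n / fact n"] by (simp add: egf_def)

text \<open>
  Geometric growth makes the exponential generating functions of \<open>p\<close> and of its shifts converge on
  the whole line, with majorants that also serve for Tannery's theorem.
\<close>
locale geometric_growth =
  fixes p :: "nat \<Rightarrow> real" and C B :: real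
  assumes growth: "\<bar>p n\<bar> \<le> C * B ^ n" and B: "0 < B"
begin

lemma summable_majorant: "summable (\<lambda>n. C * B ^ k * ((B * \<bar>x\<bar>) ^ n / fact n))"
  using summable_exp_generic[of "B * \<bar>x\<bar>"]
  by (intro summable_mult) (simp add: divide_inverse mult.commute)

lemma majorant: "\<bar>p (k + n) / fact n * x ^ n\<bar> \<le> C * B ^ k * ((B * \<bar>x\<bar>) ^ n / fact n)"
proof -
  have "\<bar>p (k + n) / fact n * x ^ n\<bar> = \<bar>p (k + n)\<bar> * (\<bar>x\<bar> ^ n / fact n)" by (simp add: abs_mult power_abs)
  also have "\<dots> \<le> C * B ^ (k + n) * (\<bar>x\<bar> ^ n / fact n)" by (intro mult_right_mono growth) simp
  finally show ?thesis by (simp add: power_add power_mult_distrib mult_ac)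
qed

lemma summable_egf: "summable (\<lambda>n. p (k + n) / fact n * x ^ n)"
  by (rule summable_comparison_test[OF _ summable_majorant]) (use majorant in auto)

lemma has_real_derivative_egf:
  "(egf (\<lambda>n. p (k + n)) has_real_derivative egf (\<lambda>n. p (Suc k + n)) x) (at x)"
proof -
  have "diffs (\<lambda>n. p (k + n) / fact n) = (\<lambda>n. p (Suc k + n) / fact n)"
    by (auto simp: diffs_def divide_simps simp del: of_nat_Suc)
  then show ?thesis
    using termdiffs_strong_converges_everywhere[OF summable_egf, of k x] by (simp add: egf_def[abs_def])
qed

end

lemma tendsto_choose_scaled:
  "(\<lambda>m. real (m choose n) * (x / real m) ^ n) \<longlonglongrightarrow> x ^ n / fact n"
proof -
  have "eventually (\<lambda>m. (\<Prod>i = 0..<n. x * (1 - real i / real m)) / fact n = real (m choose n) * (x / real m) ^ n) sequentially"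
    using eventually_gt_at_top[of 0]
  proof eventually_elim
    case (elim m)
    have "(\<Prod>i = 0..<n. x * (1 - real i / real m)) = (\<Prod>i = 0..<n. (real m - real i) * (x / real m))"
      using elim by (intro prod.cong) (auto simp: field_simps)
    also have "\<dots> = (\<Prod>i = 0..<n. real m - real i) * (x / real m) ^ n" by (subst prod.distrib) simp
    finally show ?case by (simp add: binomial_gbinomial gbinomial_prod_rev)
  qed
  moreover have "(\<lambda>m. (\<Prod>i = 0..<n. x * (1 - real i / real m)) / fact n) \<longlonglongrightarrow> (\<Prod>i = 0..<n. x * (1 - 0)) / fact n"
    by (intro tendsto_intros tendsto_divide_0[OF tendsto_const] filterlim_at_top_imp_at_infinity filterlim_real_sequentially) auto
  ultimately show ?thesis by (simp add: filterlim_cong[OF refl refl, of _ _ sequentially] Lim_transform_eventually)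
qed

context geometric_growth
begin

text \<open>
  The limit \<open>(1 + (x/m) * Shift)\<^sup>m \<longlonglongrightarrow> exp (x * Shift)\<close>, entry by entry.
\<close>
lemma tendsto_shift_mix_funpow:
  assumes x: "0 \<le> x"
  shows "(\<lambda>m. (shift_mix (x / real m) ^^ m) p k) \<longlonglongrightarrow> egf (\<lambda>n. p (k + n)) x"
proof -
  define a where "a n m = real (m choose n) * (x / real m) ^ n * p (k + n)" for n m
  have lim: "(\<lambda>m. a n m) \<longlonglongrightarrow> x ^ n / fact n * p (k + n)" for n
    unfolding a_def by (intro tendsto_mult tendsto_choose_scaled tendsto_const)
  have bd: "norm (a n m) \<le> C * B ^ k * ((B * \<bar>x\<bar>) ^ n / fact n)" for n m
  proof -
    have "real (m choose n) * (x / real m) ^ n \<le> x ^ n / fact n"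
    proof (cases "m = 0")
      case False
      have "real ((m choose n) * fact n) \<le> real (m ^ n)" using binomial_fact_pow[of m n] by (simp only: of_nat_le_iff)
      then have "real (m choose n) * fact n * x ^ n \<le> real m ^ n * x ^ n" using x by (intro mult_right_mono) auto
      then show ?thesis using False by (simp add: power_divide field_simps)
    qed (use x in \<open>cases n; auto\<close>)
    then have "\<bar>p (k + n)\<bar> * (real (m choose n) * (x / real m) ^ n) \<le> \<bar>p (k + n)\<bar> * (x ^ n / fact n)"
      by (intro mult_left_mono) auto
    also have "\<dots> = \<bar>p (k + n) / fact n * x ^ n\<bar>" using x by (simp add: abs_mult)
    also have "\<dots> \<le> C * B ^ k * ((B * \<bar>x\<bar>) ^ n / fact n)" by (rule majorant)
    finally show ?thesis using x by (simp add: a_def abs_mult mult_ac)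
  qed
  have "(\<lambda>m. suminf (\<lambda>n. a n m)) \<longlonglongrightarrow> (\<Sum>n. x ^ n / fact n * p (k + n))"
  proof -
    have "\<forall>\<^sub>F (n, m) in sequentially \<times>\<^sub>F sequentially. norm (a n m) \<le> C * B ^ k * ((B * \<bar>x\<bar>) ^ n / fact n)"
      using bd by (intro always_eventually) auto
    from tannerys_theorem[OF lim this summable_majorant trivial_limit_sequentially] show ?thesis by blast
  qed
  moreover have "suminf (\<lambda>n. a n m) = (shift_mix (x / real m) ^^ m) p k" for m
    unfolding shift_mix_funpow a_def by (subst suminf_finite[of "{..m}"]) auto
  moreover have "(\<Sum>n. x ^ n / fact n * p (k + n)) = egf (\<lambda>n. p (k + n)) x"
    by (simp add: egf_def mult.commute)
  ultimately show ?thesis by simp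
qed

lemma pf2_seq_egf:
  assumes p: "pf2_seq p" and x: "0 \<le> x"
  shows "pf2_seq (\<lambda>k. egf (\<lambda>n. p (k + n)) x)"
proof -
  have m: "pf2_seq ((shift_mix e ^^ m) p)" if "0 \<le> e" for e m
    using that p by (induction m) (auto intro: pf2_seq_shift_mix)
  note L = tendsto_shift_mix_funpow[OF x]
  have e: "0 \<le> x / real m" for m using x by simp
  show ?thesis
    unfolding pf2_seq_def
  proof (intro conjI allI impI)
    show "0 \<le> egf (\<lambda>n. p (k + n)) x" for k
      by (rule LIMSEQ_le_const[OF L]) (use pf2_seqD(1)[OF m[OF e]] in auto)
    fix i j :: nat assume ij: "i \<le> j"
    show "egf (\<lambda>n. p (i + n)) x * egf (\<lambda>n. p (Suc j + n)) x \<le> egf (\<lambda>n. p (Suc i + n)) x * egf (\<lambda>n. p (j + n)) x"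
      by (rule LIMSEQ_le[OF tendsto_mult[OF L L] tendsto_mult[OF L L]]) (use pf2_seqD(2)[OF m[OF e] ij] in auto)
  qed
qed

text \<open>
  The k-th derivative of the generating function at \<open>x\<close> is the k-th entry of \<open>exp (x * Shift) p\<close>; the minor
  with the entries 0, 1, 2 is the differential inequality for log-concavity.
\<close>
theorem log_concave_on_egf:
  assumes p: "pf2_seq p"
  shows "log_concave_on {0..} (egf p)"
proof (cases "\<exists>n. p n \<noteq> 0")
  case False
  then have "egf p = (\<lambda>x. 0)" by (auto simp: egf_def)
  then show ?thesis by (simp add: log_concave_on_def)
next
  case True
  then obtain n0 where n0: "0 < p n0" using pf2_seqD(1)[OF p] by (metis less_le)
  have "log_concave_on {0..} (egf (\<lambda>n. p (0 + n)))"
  proof (rule log_concave_on_half_line_of_derivs[OF has_real_derivative_egf has_real_derivative_egf])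
    fix x :: real assume x: "0 < x"
    show "egf (\<lambda>n. p (0 + n)) x * egf (\<lambda>n. p (Suc (Suc 0) + n)) x \<le> egf (\<lambda>n. p (Suc 0 + n)) x * egf (\<lambda>n. p (Suc 0 + n)) x"
      using pf2_seqD(2)[OF pf2_seq_egf[OF p, of x], of 0 1] x by simp
    show "0 < egf (\<lambda>n. p (0 + n)) x"
      unfolding egf_def using x n0 pf2_seqD(1)[OF p]
      by (intro suminf_pos2[where i = n0] summable_egf) (auto intro!: mult_nonneg_nonneg)
  next
    show "0 \<le> egf (\<lambda>n. p (0 + n)) 0" using pf2_seqD(1)[OF p] by (simp add: egf_0)
  qed
  then show ?thesis by simp
qed

end

text \<open>
  On the half-line this is \<open>\<Sum>a n * r\<^sup>n * erlang_density n r x\<close>, the density of the mixture of gamma laws with shape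
  \<open>n+1\<close> and rate \<open>r\<close>, with weights \<open>a n * r\<^sup>n\<close>.
\<close>
definition gamma_mixture :: "(nat \<Rightarrow> real) \<Rightarrow> real \<Rightarrow> real \<Rightarrow> real" where
  "gamma_mixture a r x = r * exp (- r * x) * egf a (r\<^sup>2 * x)"

lemma gamma_mixture_growth:
  assumes a: "\<And>n. 0 \<le> a n" and r: "0 < r" and sm: "summable (\<lambda>n. a n * r ^ n)"
  shows "geometric_growth a (\<Sum>n. a n * r ^ n) (1 / r)"
proof
  fix n
  have "a n * r ^ n \<le> (\<Sum>n. a n * r ^ n)"
    using sum_le_suminf[OF sm, of "{n}"] a r by simp
  then show "\<bar>a n\<bar> \<le> (\<Sum>n. a n * r ^ n) * (1 / r) ^ n"
    using a[of n] r by (simp add: field_simps power_divide)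
qed (use r in simp)

lemma borel_measurable_gamma_mixture:
  assumes "\<And>n. 0 \<le> a n" "0 < r" "summable (\<lambda>n. a n * r ^ n)"
  shows "gamma_mixture a r \<in> borel_measurable borel"
proof -
  interpret geometric_growth a "\<Sum>n. a n * r ^ n" "1 / r" using assms by (rule gamma_mixture_growth)
  have "continuous_on UNIV (egf a)"
    using has_real_derivative_egf[of 0] by (intro continuous_at_imp_continuous_on ballI DERIV_isCont) auto
  then have [measurable]: "egf a \<in> borel_measurable borel" by (rule borel_measurable_continuous_onI)
  show ?thesis unfolding gamma_mixture_def[abs_def] by measurable
qed

lemma log_concave_on_gamma_mixture:
  assumes "pf2_seq a" "0 < r" "summable (\<lambda>n. a n * r ^ n)"
  shows "log_concave_on {0..} (gamma_mixture a r)"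
proof -
  interpret geometric_growth a "\<Sum>n. a n * r ^ n" "1 / r"
    using assms pf2_seqD(1) by (intro gamma_mixture_growth) auto
  show ?thesis unfolding gamma_mixture_def[abs_def]
    using assms by (intro log_concave_on_exp_scale log_concave_on_egf) auto
qed

text \<open>
  Multiplying a gamma density of rate \<open>r\<close> by \<open>exp (-s x)\<close> gives a multiple of the gamma density of rate \<open>r + s\<close>, so
  the series can be integrated term by term.
\<close>
lemma laplace_gamma_mixture:
  assumes a: "\<And>n. 0 \<le> a n" and r: "0 < r" and sm: "summable (\<lambda>n. a n * r ^ n)" and s: "0 \<le> s"
  shows "(\<integral>\<^sup>+x. ennreal (exp (- s * x) * gamma_mixture a r x) * indicator {0..} x \<partial>lborel)
     = ennreal (r / (r + s) * (\<Sum>n. a n * (r\<^sup>2 / (r + s)) ^ n))"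
proof -
  interpret geometric_growth a "\<Sum>n. a n * r ^ n" "1 / r" using a r sm by (rule gamma_mixture_growth)
  define q where "q = r + s"
  have q: "0 < q" "r \<le> q" using r s by (auto simp: q_def)
  define w where "w n = r / q * (a n * (r\<^sup>2 / q) ^ n)" for n
  have w: "0 \<le> w n" for n using a r q by (simp add: w_def)
  have "r\<^sup>2 / q \<le> r" using q r by (simp add: power2_eq_square field_simps)
  then have sm': "summable (\<lambda>n. a n * (r\<^sup>2 / q) ^ n)"
    using a r q by (intro summable_comparison_test[OF _ sm]) (auto intro!: mult_left_mono power_mono)
  have pt: "ennreal (exp (- s * x) * gamma_mixture a r x) * indicator {0..} x
     = (\<Sum>n. ennreal (w n) * ennreal (erlang_density n q x))" for x
  proof (cases "0 \<le> x")
    case True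
    have eq: "r * exp (- q * x) * (a n / fact n * (r\<^sup>2 * x) ^ n) = w n * erlang_density n q x" for n
      using True q by (simp add: w_def erlang_density_def power_divide power_mult_distrib)
    have "(\<lambda>n. r * exp (- q * x) * (a n / fact n * (r\<^sup>2 * x) ^ n)) sums (r * exp (- q * x) * egf a (r\<^sup>2 * x))"
      unfolding egf_def using summable_egf[of 0 "r\<^sup>2 * x"] by (intro sums_mult summable_sums) simp
    also have "r * exp (- q * x) * egf a (r\<^sup>2 * x) = exp (- s * x) * gamma_mixture a r x"
      by (simp add: gamma_mixture_def q_def algebra_simps exp_add[symmetric])
    finally have S: "(\<lambda>n. w n * erlang_density n q x) sums (exp (- s * x) * gamma_mixture a r x)"
      by (simp only: eq)
    have we: "0 \<le> w n * erlang_density n q x" for n using w q by simp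
    have nn: "0 \<le> exp (- s * x) * gamma_mixture a r x" by (rule sums_le[OF we sums_zero S])
    have "(\<lambda>n. ennreal (w n * erlang_density n q x)) sums ennreal (exp (- s * x) * gamma_mixture a r x)"
      by (rule iffD2[OF sums_ennreal[OF we nn] S])
    then have "(\<lambda>n. ennreal (w n) * ennreal (erlang_density n q x)) sums ennreal (exp (- s * x) * gamma_mixture a r x)"
      using w q by (simp only: ennreal_mult erlang_density_nonneg less_imp_le)
    then show ?thesis using True by (simp add: sums_iff)
  qed (simp add: erlang_density_def)
  have "(\<integral>\<^sup>+x. ennreal (exp (- s * x) * gamma_mixture a r x) * indicator {0..} x \<partial>lborel)
     = (\<Sum>n. \<integral>\<^sup>+x. ennreal (w n) * ennreal (erlang_density n q x) \<partial>lborel)"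
    unfolding pt by (rule nn_integral_suminf) measurable
  also have "\<dots> = (\<Sum>n. ennreal (w n))"
  proof (rule suminf_cong)
    fix n
    have "(\<integral>\<^sup>+x. ennreal (erlang_density n q x) \<partial>lborel) = 1"
      using nn_integral_erlang_ith_moment[OF q(1), of n 0] by simp
    then show "(\<integral>\<^sup>+x. ennreal (w n) * ennreal (erlang_density n q x) \<partial>lborel) = ennreal (w n)"
      by (subst nn_integral_cmult) auto
  qed
  also have "\<dots> = ennreal (\<Sum>n. w n)"
    using w sm' unfolding w_def by (intro suminf_ennreal2 summable_mult) auto
  also have "(\<Sum>n. w n) = r / q * (\<Sum>n. a n * (r\<^sup>2 / q) ^ n)"
    unfolding w_def using sm' by (rule suminf_mult)
  finally show ?thesis by (simp add: q_def)
qed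

section \<open>Laplace limits of log-concave functions that concentrate\<close>

lemma log_concave_onD:
  fixes f :: "real \<Rightarrow> real"
  assumes "log_concave_on {0..} f" "0 \<le> x" "0 \<le> y" "0 < l" "l < 1"
  shows "f x powr l * f y powr (1 - l) \<le> f (l * x + (1 - l) * y)"
proof -
  have "f x powr l * f y powr (1 - l) \<le> f (l *\<^sub>R x + (1 - l) *\<^sub>R y)"
    using assms unfolding log_concave_on_def by (auto simp del: real_scaleR_def)
  then show ?thesis by (simp only: real_scaleR_def)
qed

lemma log_concave_on_between:
  fixes f :: "real \<Rightarrow> real"
  assumes f: "log_concave_on {0..} f" and "0 \<le> a" "a \<le> z" "z \<le> b" and c: "0 \<le> c" "c \<le> f a" "c \<le> f b"
  shows "c \<le> f z"
proof (cases "z = a \<or> z = b")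
  case True
  then show ?thesis using c by auto
next
  case False
  then have ab: "a < z" "z < b" using assms by auto
  define l where "l = (b - z) / (b - a)"
  have l: "0 < l" "l < 1" using ab by (auto simp: l_def field_simps)
  have L: "l * (b - a) = b - z" using ab by (simp add: l_def)
  have "c = c powr l * c powr (1 - l)" using c by (cases "c = 0") (auto simp flip: powr_add)
  also have "\<dots> \<le> f a powr l * f b powr (1 - l)"
    using c l by (intro mult_mono powr_mono2) auto
  also have "\<dots> \<le> f (l * a + (1 - l) * b)"
    using assms by (intro log_concave_onD[OF f] l) auto
  also have "l * a + (1 - l) * b = z" using L by (simp add: algebra_simps)
  finally show ?thesis .
qed

text \<open>
  The quotient of the values at 2 and 1 determines the limit \<open>q\<close> of \<open>exp (-u k)\<close>, although \<open>m\<close> is not known to converge;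
  all other values then follow from the one at 1. Positivity at 2 keeps \<open>q\<close> away from 0, that is, it
  keeps the point masses from escaping to infinity.
\<close>
lemma exponential_of_point_mass_limit:
  fixes m u :: "nat \<Rightarrow> real" and \<phi> :: "real \<Rightarrow> real"
  assumes u: "\<And>k. 0 \<le> u k"
    and lim: "\<And>s. 0 < s \<Longrightarrow> (\<lambda>k. m k * exp (- s * u k)) \<longlonglongrightarrow> \<phi> s"
    and pos: "0 < \<phi> 1" "0 < \<phi> 2"
  shows "\<exists>c x0. 0 \<le> c \<and> 0 \<le> x0 \<and> (\<forall>s>0. \<phi> s = c * exp (- s * x0))"
proof -
  define q where "q = \<phi> 2 / \<phi> 1"
  have q: "0 < q" using pos by (simp add: q_def)
  have lim1: "(\<lambda>k. m k * exp (- u k)) \<longlonglongrightarrow> \<phi> 1" using lim[of 1] by simp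
  have lim2: "(\<lambda>k. m k * exp (- 2 * u k)) \<longlonglongrightarrow> \<phi> 2" using lim[of 2] by simp
  have ev: "\<forall>\<^sub>F k in sequentially. 0 < m k * exp (- u k)"
    using order_tendstoD(1)[OF lim1 pos(1)] .
  have limq: "(\<lambda>k. exp (- u k)) \<longlonglongrightarrow> q"
  proof (rule Lim_transform_eventually)
    show "(\<lambda>k. (m k * exp (- 2 * u k)) / (m k * exp (- u k))) \<longlonglongrightarrow> q"
      unfolding q_def using pos by (intro tendsto_divide lim1 lim2) simp
    show "\<forall>\<^sub>F k in sequentially. (m k * exp (- 2 * u k)) / (m k * exp (- u k)) = exp (- u k)"
      using ev
    proof eventually_elim
      case (elim k)
      have "exp (- 2 * u k) = exp (- u k) * exp (- u k)" by (simp flip: exp_add)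
      moreover have "m k \<noteq> 0" using elim by auto
      ultimately show ?case by (simp add: field_simps)
    qed
  qed
  have "q \<le> 1" by (rule LIMSEQ_le_const2[OF limq]) (use u in auto)
  have formula: "\<phi> s = \<phi> 1 / q * exp (- s * (- ln q))" if s: "0 < s" for s
  proof -
    have "(\<lambda>k. (m k * exp (- u k)) * exp (- u k) powr (s - 1)) \<longlonglongrightarrow> \<phi> 1 * q powr (s - 1)"
      using q by (intro tendsto_mult lim1 tendsto_powr limq tendsto_const) simp
    also have "(\<lambda>k. (m k * exp (- u k)) * exp (- u k) powr (s - 1)) = (\<lambda>k. m k * exp (- s * u k))"
      by (rule ext) (simp add: powr_def mult.assoc flip: exp_add, simp add: algebra_simps)
    finally have "\<phi> s = \<phi> 1 * q powr (s - 1)" using LIMSEQ_unique lim[OF s] by blast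
    then show ?thesis using q by (simp add: powr_def algebra_simps exp_diff)
  qed
  have "0 \<le> \<phi> 1 / q" "0 \<le> - ln q" using q \<open>q \<le> 1\<close> pos(1) by simp_all
  with formula show ?thesis by blast
qed

lemma erlang_0_integral:
  assumes "0 < s"
  shows "integrable lborel (erlang_density 0 s)" "(\<integral>x. erlang_density 0 s x \<partial>lborel) = 1"
proof -
  have nn: "(\<integral>\<^sup>+x. ennreal (erlang_density 0 s x) \<partial>lborel) = 1"
    using nn_integral_erlang_ith_moment[OF assms, of 0 0] by simp
  show "integrable lborel (erlang_density 0 s)"
    using assms nn by (intro integrableI_nonneg) auto
  show "(\<integral>x. erlang_density 0 s x \<partial>lborel) = 1"
    using assms by (subst integral_eq_nn_integral) (auto simp: nn)
qed

text \<open>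
  The functions vanish on the negative axis, so that integrals over the half-line are integrals
  over the line.
\<close>
locale log_concave_laplace_limit =
  fixes h :: "nat \<Rightarrow> real \<Rightarrow> real" and C :: real and \<phi> :: "real \<Rightarrow> real"
  assumes measurable_h [measurable]: "h n \<in> borel_measurable borel"
    and lc: "log_concave_on {0..} (h n)"
    and zero: "x < 0 \<Longrightarrow> h n x = 0"
    and int: "integrable lborel (h n)"
    and mass: "(\<integral>x. h n x \<partial>lborel) \<le> C"
    and lap: "0 < s \<Longrightarrow> (\<lambda>n. \<integral>x. exp (- s * x) * h n x \<partial>lborel) \<longlonglongrightarrow> \<phi> s"
begin

lemma nonneg: "0 \<le> h n x"
proof (cases "0 \<le> x")
  case True
  then show ?thesis using lc[of n] by (auto simp: log_concave_on_def)
qed (simp add: zero)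

lemma integrable_exp_h:
  assumes "0 < s" shows "integrable lborel (\<lambda>x. exp (- s * x) * h n x)"
proof (rule Bochner_Integration.integrable_bound[OF int[of n]])
  show "AE x in lborel. norm (exp (- s * x) * h n x) \<le> norm (h n x)"
  proof (rule AE_I2)
    fix x
    show "norm (exp (- s * x) * h n x) \<le> norm (h n x)"
    proof (cases "0 \<le> x")
      case True
      then have "exp (- s * x) * h n x \<le> 1 * h n x" using assms nonneg by (intro mult_right_mono) auto
      then show ?thesis using nonneg by (simp add: abs_mult)
    qed (simp add: zero)
  qed
qed measurable

text \<open>
  Superlevel sets are intervals. One that is longer than \<open>2 d\<close> contains two neighbouring points of
  the grid of mesh \<open>d\<close>, and the hypothesis excludes this for the finitely many grid points up to \<open>R\<close> once
  the index is large.
\<close>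
lemma superlevel_narrow:
  assumes spread: "\<And>q r c. 0 \<le> q \<Longrightarrow> q < r \<Longrightarrow> 0 < c \<Longrightarrow> \<forall>\<^sub>F n in sequentially. \<not> (c \<le> h n q \<and> c \<le> h n r)"
    and d: "0 < d" 
  shows "\<exists>N\<ge>k. \<exists>u\<ge>0. \<forall>x. 0 \<le> x \<longrightarrow> x \<le> R \<longrightarrow> d \<le> h N x \<longrightarrow> u \<le> x \<and> x \<le> u + 2 * d"
proof -
  define J where "J = nat \<lceil>R / d\<rceil>"
  have "\<forall>\<^sub>F n in sequentially. \<forall>j\<in>{..J}. \<not> (d \<le> h n (real j * d) \<and> d \<le> h n (real (Suc j) * d))"
    using d by (intro eventually_ball_finite ballI spread) auto
  then have "\<forall>\<^sub>F n in sequentially. k \<le> n \<and> (\<forall>j\<in>{..J}. \<not> (d \<le> h n (real j * d) \<and> d \<le> h n (real (Suc j) * d)))"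
    using eventually_ge_at_top[of k] by eventually_elim simp
  then obtain N where N: "k \<le> N" "\<And>j. j \<le> J \<Longrightarrow> d \<le> h N (real j * d) \<Longrightarrow> d \<le> h N (real (Suc j) * d) \<Longrightarrow> False"
    by (metis (no_types, lifting) atMost_iff eventually_happens trivial_limit_sequentially)
  define S where "S = {x. 0 \<le> x \<and> x \<le> R \<and> d \<le> h N x}"
  have diam: "x - 2 * d \<le> v" if "x \<in> S" "v \<in> S" for x v
  proof (rule ccontr)
    assume "\<not> x - 2 * d \<le> v"
    then have xv: "v + 2 * d < x" by simp
    have v: "0 \<le> v" "v \<le> R" "d \<le> h N v" and x: "0 \<le> x" "x \<le> R" "d \<le> h N x" using that by (auto simp: S_def)
    define j where "j = nat \<lceil>v / d\<rceil>"
    have j: "real j = of_int \<lceil>v / d\<rceil>" using v d by (simp add: j_def)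
    have "v / d \<le> real j" "real j < v / d + 1" using j by linarith+
    then have jd: "v \<le> real j * d" "real j * d < v + d" using d by (auto simp: field_simps)
    then have jd': "real (Suc j) * d \<le> x" using xv by (simp add: algebra_simps)
    have step: "real j * d \<le> real (Suc j) * d" using d by (intro mult_right_mono) auto
    have "j \<le> J" unfolding j_def J_def using v d by (intro nat_mono ceiling_mono divide_right_mono) auto
    moreover have "d \<le> h N (real j * d)"
      by (rule log_concave_on_between[OF lc v(1) jd(1) order_trans[OF step jd'] less_imp_le[OF d] v(3) x(3)])
    moreover have "d \<le> h N (real (Suc j) * d)"
      by (rule log_concave_on_between[OF lc v(1) order_trans[OF jd(1) step] jd' less_imp_le[OF d] v(3) x(3)])
    ultimately show False using N(2) by blast
  qed
  show ?thesis
  proof (cases "S = {}")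
    case True
    then show ?thesis using N(1) by (intro exI[of _ N] conjI exI[of _ 0]) (auto simp: S_def)
  next
    case False
    have bdd: "bdd_below S" by (rule bdd_belowI[of _ 0]) (auto simp: S_def)
    have "0 \<le> Inf S" using False by (intro cInf_greatest) (auto simp: S_def)
    moreover have "Inf S \<le> x \<and> x \<le> Inf S + 2 * d" if "x \<in> S" for x
    proof
      show "Inf S \<le> x" using that bdd by (rule cInf_lower)
      have "x - 2 * d \<le> Inf S" using diam[OF that] False by (intro cInf_greatest) auto
      then show "x \<le> Inf S + 2 * d" by simp
    qed
    ultimately show ?thesis using N(1) by (intro exI[of _ N] conjI exI[of _ "Inf S"]) (auto simp: S_def)
  qed
qed

text \<open>
  The three error terms come from the region below the level \<open>d\<close>, from the region beyond \<open>R\<close>, and from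
  the variation of the exponential on the short interval that carries the rest of the mass.
\<close>
lemma laplace_near_point_mass:
  assumes s: "0 < s" and d: "0 < d" and R: "0 \<le> R" and u: "0 \<le> u"
    and narrow: "\<And>x. 0 \<le> x \<Longrightarrow> x \<le> R \<Longrightarrow> d \<le> h N x \<Longrightarrow> u \<le> x \<and> x \<le> u + 2 * d"
  shows "\<bar>(\<integral>x. exp (- s * x) * h N x \<partial>lborel) - (\<integral>x. h N x * indicator {u..u + 2 * d} x \<partial>lborel) * exp (- s * u)\<bar>
     \<le> d / s + exp (- s * R) * C + (1 - exp (- s * (2 * d))) * C"
proof -
  let ?B = "{u..u + 2 * d}"
  have intB: "integrable lborel (\<lambda>x. h N x * indicator ?B x)"
    using integrable_mult_indicator[OF _ int[of N], of ?B] by (simp add: mult.commute)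
  have iw: "integrable lborel (\<lambda>x. d / s * erlang_density 0 s x + (exp (- s * R) * h N x + (1 - exp (- s * (2 * d))) * h N x))"
    by (intro Bochner_Integration.integrable_add integrable_mult_right int erlang_0_integral s)
  have pt: "\<bar>exp (- s * x) * h N x - h N x * indicator ?B x * exp (- s * u)\<bar>
      \<le> d / s * erlang_density 0 s x + (exp (- s * R) * h N x + (1 - exp (- s * (2 * d))) * h N x)" for x
  proof (cases "x < 0")
    case True
    then show ?thesis using zero by (simp add: erlang_density_def)
  next
    case False
    then have x: "0 \<le> x" by simp
    have er: "d / s * erlang_density 0 s x = d * exp (- s * x)" using x s by (simp add: erlang_density_def)
    have p1: "0 \<le> d * exp (- s * x)" using d by simp
    have p2: "0 \<le> exp (- s * R) * h N x" using nonneg by simp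
    have e1: "exp (- s * (2 * d)) \<le> 1" using s d by simp
    have p3: "0 \<le> (1 - exp (- s * (2 * d))) * h N x" using nonneg e1 by (intro mult_nonneg_nonneg) auto
    have p4: "0 \<le> exp (- s * x) * h N x" using nonneg by simp
    consider "x \<in> ?B" | "x \<notin> ?B" "x \<le> R" | "x \<notin> ?B" "R < x" by linarith
    then show ?thesis
    proof cases
      case 1
      have e: "exp (- s * x) = exp (- s * u) * exp (- s * (x - u))" by (simp flip: exp_add) (simp add: algebra_simps)
      have "exp (- s * (2 * d)) \<le> exp (- s * (x - u))" "exp (- s * (x - u)) \<le> 1" using 1 s by auto
      then have "\<bar>exp (- s * (x - u)) - 1\<bar> \<le> 1 - exp (- s * (2 * d))" by linarith
      moreover have "exp (- s * u) \<le> 1" using s u by simp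
      ultimately have "exp (- s * u) * \<bar>exp (- s * (x - u)) - 1\<bar> \<le> 1 * (1 - exp (- s * (2 * d)))"
        by (intro mult_mono) auto
      moreover have "exp (- s * x) - exp (- s * u) = exp (- s * u) * (exp (- s * (x - u)) - 1)"
        unfolding e by (simp only: right_diff_distrib mult_1_right)
      ultimately have "\<bar>exp (- s * x) - exp (- s * u)\<bar> \<le> 1 - exp (- s * (2 * d))"
        by (simp only: abs_mult abs_exp_cancel mult_1_left)
      then have "\<bar>exp (- s * x) - exp (- s * u)\<bar> * h N x \<le> (1 - exp (- s * (2 * d))) * h N x"
        using nonneg by (intro mult_right_mono) auto
      moreover have "exp (- s * x) * h N x - h N x * indicator ?B x * exp (- s * u) = (exp (- s * x) - exp (- s * u)) * h N x"
        using 1 by (simp add: algebra_simps)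
      ultimately show ?thesis using p1 p2 nonneg unfolding er by (simp only: abs_mult abs_of_nonneg)
    next
      case 2
      then have "h N x < d" using narrow[OF x] by (meson atLeastAtMost_iff linorder_not_le)
      then have "exp (- s * x) * h N x \<le> d * exp (- s * x)" by (simp add: mult.commute)
      moreover have "\<bar>exp (- s * x) * h N x - h N x * indicator ?B x * exp (- s * u)\<bar> = exp (- s * x) * h N x"
      proof -
        have i0: "indicator ?B x = (0::real)" using 2(1) by (simp only: indicator_def if_False of_bool_eq)
        show ?thesis using abs_of_nonneg[OF p4] by (simp only: i0 mult_zero_left mult_zero_right diff_zero)
      qed
      ultimately show ?thesis using p2 p3 unfolding er by linarith
    next
      case 3
      then have "exp (- s * x) \<le> exp (- s * R)" using s by simp
      then have "exp (- s * x) * h N x \<le> exp (- s * R) * h N x" using nonneg by (intro mult_right_mono) auto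
      moreover have "\<bar>exp (- s * x) * h N x - h N x * indicator ?B x * exp (- s * u)\<bar> = exp (- s * x) * h N x"
      proof -
        have i0: "indicator ?B x = (0::real)" using 3(1) by (simp only: indicator_def if_False of_bool_eq)
        show ?thesis using abs_of_nonneg[OF p4] by (simp only: i0 mult_zero_left mult_zero_right diff_zero)
      qed
      ultimately show ?thesis using p1 p3 unfolding er by linarith
    qed
  qed
  have "(\<integral>x. exp (- s * x) * h N x \<partial>lborel) - (\<integral>x. h N x * indicator ?B x \<partial>lborel) * exp (- s * u)
      = (\<integral>x. exp (- s * x) * h N x \<partial>lborel) - (\<integral>x. h N x * indicator ?B x * exp (- s * u) \<partial>lborel)"
    by (simp only: integral_mult_left_zero)
  also have "\<dots> = (\<integral>x. exp (- s * x) * h N x - h N x * indicator ?B x * exp (- s * u) \<partial>lborel)"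
    by (intro Bochner_Integration.integral_diff[symmetric] integrable_exp_h s integrable_mult_left intB)
  finally have eq: "(\<integral>x. exp (- s * x) * h N x \<partial>lborel) - (\<integral>x. h N x * indicator ?B x \<partial>lborel) * exp (- s * u)
      = (\<integral>x. exp (- s * x) * h N x - h N x * indicator ?B x * exp (- s * u) \<partial>lborel)" .
  have "\<bar>\<integral>x. exp (- s * x) * h N x - h N x * indicator ?B x * exp (- s * u) \<partial>lborel\<bar>
      \<le> (\<integral>x. d / s * erlang_density 0 s x + (exp (- s * R) * h N x + (1 - exp (- s * (2 * d))) * h N x) \<partial>lborel)"
    by (rule order_trans[OF integral_abs_bound],
        rule integral_mono[OF integrable_abs[OF Bochner_Integration.integrable_diff[OF integrable_exp_h[OF s] integrable_mult_left[OF intB]]] iw pt])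
  also have "\<dots> = d / s * (\<integral>x. erlang_density 0 s x \<partial>lborel) + (exp (- s * R) * (\<integral>x. h N x \<partial>lborel) + (1 - exp (- s * (2 * d))) * (\<integral>x. h N x \<partial>lborel))"
  proof -
    note i = integrable_mult_right[OF erlang_0_integral(1)[OF s], of "d / s"] integrable_mult_right[OF int[of N], of "exp (- s * R)"]
      integrable_mult_right[OF int[of N], of "1 - exp (- s * (2 * d))"]
    show ?thesis
      by (simp only: Bochner_Integration.integral_add[OF i(1) Bochner_Integration.integrable_add[OF i(2,3)]]
          Bochner_Integration.integral_add[OF i(2,3)] integral_mult_right_zero)
  qed
  also have "\<dots> \<le> d / s * 1 + (exp (- s * R) * C + (1 - exp (- s * (2 * d))) * C)"
  proof -
    have "0 \<le> 1 - exp (- s * (2 * d))" using s d by simp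
    then show ?thesis unfolding erlang_0_integral(2)[OF s]
      by (intro add_left_mono add_mono mult_left_mono mass) auto
  qed
  finally show ?thesis unfolding eq by (simp only: mult_1_right add.assoc)
qed

lemma concentrated_limit:
  assumes spread: "\<And>q r c. 0 \<le> q \<Longrightarrow> q < r \<Longrightarrow> 0 < c \<Longrightarrow> \<forall>\<^sub>F n in sequentially. \<not> (c \<le> h n q \<and> c \<le> h n r)"
    and pos: "0 < \<phi> 1" "0 < \<phi> 2"
  shows "\<exists>c x0. 0 \<le> c \<and> 0 \<le> x0 \<and> (\<forall>s>0. \<phi> s = c * exp (- s * x0))"
proof -
  define d where "d k = 1 / real (Suc k)" for k
  have d: "0 < d k" for k by (simp add: d_def)
  have "\<forall>k. \<exists>N u. k \<le> N \<and> 0 \<le> u \<and> (\<forall>x. 0 \<le> x \<longrightarrow> x \<le> real k \<longrightarrow> d k \<le> h N x \<longrightarrow> u \<le> x \<and> x \<le> u + 2 * d k)"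
    using superlevel_narrow[OF spread d] by blast
  then obtain N u where N: "\<And>k. k \<le> N k" and u: "\<And>k. 0 \<le> u k"
    and narrow: "\<And>k x. 0 \<le> x \<Longrightarrow> x \<le> real k \<Longrightarrow> d k \<le> h (N k) x \<Longrightarrow> u k \<le> x \<and> x \<le> u k + 2 * d k"
    by metis
  define m where "m k = (\<integral>x. h (N k) x * indicator {u k..u k + 2 * d k} x \<partial>lborel)" for k
  have Ntop: "filterlim N sequentially sequentially"
    by (rule filterlim_at_top_mono[OF filterlim_ident]) (use N in auto)
  have d0: "d \<longlonglongrightarrow> 0" unfolding d_def by (rule LIMSEQ_Suc[OF lim_1_over_n])
  have "(\<lambda>k. m k * exp (- s * u k)) \<longlonglongrightarrow> \<phi> s" if s: "0 < s" for s
  proof -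
    define A where "A k = (\<integral>x. exp (- s * x) * h (N k) x \<partial>lborel)" for k
    define E where "E k = d k / s + exp (- s * real k) * C + (1 - exp (- s * (2 * d k))) * C" for k
    have A: "A \<longlonglongrightarrow> \<phi> s" unfolding A_def by (rule filterlim_compose[OF lap[OF s] Ntop])
    have "(\<lambda>k. exp (- s * real k)) \<longlonglongrightarrow> 0"
      using s by (intro filterlim_compose[OF exp_at_bot] filterlim_tendsto_neg_mult_at_bot[OF tendsto_const _ filterlim_real_sequentially]) auto
    then have "E \<longlonglongrightarrow> 0 / s + 0 * C + (1 - exp (- s * (2 * 0))) * C"
      unfolding E_def using s d0 by (intro tendsto_intros) auto
    then have E: "E \<longlonglongrightarrow> 0" by simp
    have "\<bar>A k - m k * exp (- s * u k)\<bar> \<le> E k" for k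
      unfolding A_def m_def E_def by (intro laplace_near_point_mass s d u narrow) auto
    then have "(\<lambda>k. A k - m k * exp (- s * u k)) \<longlonglongrightarrow> 0"
      by (intro Lim_null_comparison[OF _ E]) (simp add: always_eventually)
    from tendsto_diff[OF A this] show ?thesis by simp
  qed
  from exponential_of_point_mass_limit[OF u this pos] show ?thesis .
qed

end

section \<open>Laplace limits of log-concave functions that stay spread out\<close>

text \<open>
  A value at \<open>x\<close> that is large compared with \<open>c\<close> forces the geometric mean of that value and \<open>c\<close> on half
  of the segment from \<open>x\<close> to a point where \<open>f \<ge> c\<close>. Choosing the point that is farther from \<open>x\<close>
  makes this segment at least \<open>(r - q) / 2\<close> long, so the mass bounds the geometric mean.
\<close>
lemma log_concave_on_bounded_by_mass:
  fixes f :: "real \<Rightarrow> real"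
  assumes f: "log_concave_on {0..} f" and nn: "\<And>x. 0 \<le> f x"
    and int: "integrable lborel f" and mass: "(\<integral>x. f x \<partial>lborel) \<le> C"
    and qr: "0 \<le> q" "q < r" and c: "0 < c" "c \<le> f q" "c \<le> f r" and x: "0 \<le> x"
  shows "f x \<le> max c (16 * C\<^sup>2 / (c * (r - q)\<^sup>2))"
proof (cases "f x \<le> c")
  case False
  define p where "p = (if (r - q) / 2 \<le> \<bar>x - q\<bar> then q else r)"
  have p: "0 \<le> p" "c \<le> f p" and far: "(r - q) / 2 \<le> \<bar>x - p\<bar>"
    using qr c by (auto simp: p_def abs_if field_simps split: if_splits)
  define y where "y = (x + p) / 2"
  define a b where "a = min x y" and "b = max x y"
  have len: "(r - q) / 4 \<le> b - a" using far by (auto simp: a_def b_def y_def min_def max_def abs_if field_simps split: if_splits)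
  have big: "sqrt (f x * c) \<le> f z" if z: "z \<in> {a..b}" for z
  proof (cases "z = x")
    case True
    have "f x * c \<le> f x * f x" using False c nn by (intro mult_left_mono) auto
    then have "sqrt (f x * c) \<le> sqrt (f x * f x)" by (rule real_sqrt_le_mono)
    then show ?thesis using nn[of x] True by simp
  next
    case neq: False
    define l where "l = (z - p) / (x - p)"
    have xp: "x \<noteq> p" using far qr by auto
    have L: "l * (x - p) = z - p" using xp by (simp add: l_def)
    have l: "1 / 2 \<le> l" "l \<le> 1"
      using z xp by (auto simp: l_def a_def b_def y_def min_def max_def divide_simps split: if_splits)
    have "l \<noteq> 1" using L neq by auto
    then have l1: "0 < l" "l < 1" using l by auto
    have fx: "0 < f x" using False c by simp
    have "sqrt (f x * c) = exp ((1 / 2) * ln (f x) + (1 / 2) * ln c)"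
      using fx c(1) by (simp add: powr_half_sqrt[symmetric] powr_def ln_mult) 
    also have "\<dots> \<le> exp (l * ln (f x) + (1 - l) * ln c)"
    proof -
      have "ln c \<le> ln (f x)" using False c fx by simp
      then have "0 \<le> (l - 1 / 2) * (ln (f x) - ln c)" using l by (intro mult_nonneg_nonneg) auto
      then show ?thesis by (simp add: algebra_simps)
    qed
    also have "\<dots> = f x powr l * c powr (1 - l)" using fx c by (simp add: powr_def exp_add)
    also have "\<dots> \<le> f x powr l * f p powr (1 - l)"
      using c p l1 by (intro mult_left_mono powr_mono2) auto
    also have "\<dots> \<le> f (l * x + (1 - l) * p)"
      by (rule log_concave_onD[OF f x p(1) l1])
    also have "l * x + (1 - l) * p = z" using L by (simp add: algebra_simps)
    finally show ?thesis .
  qed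
  have ab: "a \<le> b" by (simp add: a_def b_def)
  have "sqrt (f x * c) * (b - a) = (\<integral>z. sqrt (f x * c) * indicator {a..b} z \<partial>lborel)"
    using ab by simp
  also have "\<dots> \<le> (\<integral>z. f z \<partial>lborel)"
  proof (rule integral_mono[OF _ int])
    show "integrable lborel (\<lambda>z. sqrt (f x * c) * indicator {a..b} z)"
      by (intro integrable_mult_right integrable_real_indicator) (simp_all add: ab)
    show "sqrt (f x * c) * indicator {a..b} z \<le> f z" for z
      using big[of z] nn[of z] by (cases "z \<in> {a..b}") simp_all
  qed
  also have "\<dots> \<le> C" by (rule mass)
  finally have "sqrt (f x * c) * (b - a) \<le> C" .
  moreover have "sqrt (f x * c) * ((r - q) / 4) \<le> sqrt (f x * c) * (b - a)"
    using len nn[of x] c by (intro mult_left_mono) auto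
  ultimately have "sqrt (f x * c) * ((r - q) / 4) \<le> C" by linarith
  then have "(sqrt (f x * c) * ((r - q) / 4))\<^sup>2 \<le> C\<^sup>2"
    using nn[of x] c qr by (intro power_mono) auto
  then have "f x * c * (r - q)\<^sup>2 \<le> 16 * C\<^sup>2"
    using nn[of x] c by (simp add: power_mult_distrib power_divide)
  moreover have "0 < c * (r - q)\<^sup>2" using c qr by simp
  ultimately have "f x \<le> 16 * C\<^sup>2 / (c * (r - q)\<^sup>2)"
    by (subst pos_le_divide_eq) (simp_all only: mult.assoc)
  then show ?thesis by simp
qed simp

text \<open>
  The lower limit of a bounded real sequence is written as the limit of its tail infima: infima and
  monotone limits both preserve log-concavity, which upper limits do not.
\<close>
lemma tail_infimum_facts:
  fixes f :: "nat \<Rightarrow> real"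
  assumes bd: "\<And>n. 0 \<le> f n" "\<And>n. f n \<le> M"
  defines "G \<equiv> \<lambda>n. INF m\<in>{n..}. f m"
  shows "n \<le> m \<Longrightarrow> G n \<le> f m"
    and "(\<And>m. n \<le> m \<Longrightarrow> c \<le> f m) \<Longrightarrow> c \<le> G n"
    and "0 \<le> G n" and "G \<longlonglongrightarrow> lim G" and "0 \<le> lim G"
    and "f \<longlonglongrightarrow> l \<Longrightarrow> lim G = l"
    and "y < lim G \<Longrightarrow> \<forall>\<^sub>F n in sequentially. y < f n"
proof -
  have bdd: "bdd_below (f ` {n..})" for n using bd by (intro bdd_belowI[of _ 0]) auto
  show le: "G n \<le> f m" if "n \<le> m" for n m
    unfolding G_def using that by (intro cINF_lower bdd) auto
  show ge: "c \<le> G n" if "\<And>m. n \<le> m \<Longrightarrow> c \<le> f m" for n c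
    unfolding G_def using that by (intro cINF_greatest) auto
  show G0: "0 \<le> G n" for n using bd by (intro ge)
  have GM: "G n \<le> M" for n using le[of n n] bd(2)[of n] by simp
  have inc: "incseq G" by (intro incseq_SucI ge le) auto
  obtain L where "G \<longlonglongrightarrow> L" using incseq_convergent[OF inc, of M] GM by blast
  then have "convergent G" by (rule convergentI)
  then show L: "G \<longlonglongrightarrow> lim G" by (simp add: convergent_LIMSEQ_iff)
  show "0 \<le> lim G" by (rule LIMSEQ_le_const[OF L]) (use G0 in auto)
  show "lim G = l" if f: "f \<longlonglongrightarrow> l"
  proof (rule antisym)
    show "lim G \<le> l" by (rule LIMSEQ_le[OF L f]) (use le in auto)
    show "l \<le> lim G"
    proof (rule dense_le)
      fix y assume "y < l"
      then obtain N where N: "\<And>n. N \<le> n \<Longrightarrow> y < f n"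
        using order_tendstoD(1)[OF f] by (auto simp: eventually_sequentially)
      have "y \<le> G N" using N by (intro ge less_imp_le)
      also have "G N \<le> lim G" by (rule incseq_le[OF inc L])
      finally show "y \<le> lim G" .
    qed
  qed
  show "\<forall>\<^sub>F n in sequentially. y < f n" if "y < lim G"
    using order_tendstoD(1)[OF L that] by eventually_elim (use le in \<open>blast intro: less_le_trans\<close>)
qed

text \<open>
  Pointwise convergence is known at rational points only; the point \<open>q\<close>, at which the functions stay
  above \<open>c\<close>, excludes a bump that wanders around between the rationals.
\<close>
locale log_concave_pointwise_limit =
  fixes f :: "nat \<Rightarrow> real \<Rightarrow> real" and M q c :: real
  assumes measurable_f [measurable]: "f n \<in> borel_measurable borel"
    and lc: "log_concave_on {0..} (f n)"
    and zero: "x < 0 \<Longrightarrow> f n x = 0"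
    and bounds: "0 \<le> f n x" "f n x \<le> M"
    and q: "0 \<le> q" and c: "0 < c" "c \<le> f n q"
    and conv: "x \<in> \<rat> \<Longrightarrow> 0 \<le> x \<Longrightarrow> convergent (\<lambda>n. f n x)"
begin

definition tail_inf :: "nat \<Rightarrow> real \<Rightarrow> real" where
  "tail_inf n x = (INF m\<in>{n..}. f m x)"

definition lim_inf :: "real \<Rightarrow> real" where
  "lim_inf x = lim (\<lambda>n. tail_inf n x)"

lemma
  shows tail_inf_le: "n \<le> m \<Longrightarrow> tail_inf n x \<le> f m x"
    and tail_inf_greatest: "(\<And>m. n \<le> m \<Longrightarrow> d \<le> f m x) \<Longrightarrow> d \<le> tail_inf n x"
    and tail_inf_nonneg: "0 \<le> tail_inf n x"
    and tail_inf_tendsto: "(\<lambda>n. tail_inf n x) \<longlonglongrightarrow> lim_inf x"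
    and lim_inf_nonneg: "0 \<le> lim_inf x"
    and lim_inf_eqI: "(\<lambda>n. f n x) \<longlonglongrightarrow> l \<Longrightarrow> lim_inf x = l"
    and eventually_gt: "y < lim_inf x \<Longrightarrow> \<forall>\<^sub>F n in sequentially. y < f n x"
  unfolding lim_inf_def tail_inf_def
  by (fact tail_infimum_facts[where f = "\<lambda>n. f n x" and M = M, OF bounds])+

lemma measurable_lim_inf [measurable]: "lim_inf \<in> borel_measurable borel"
  unfolding lim_inf_def[abs_def] tail_inf_def by (intro borel_measurable_lim_metric borel_measurable_cINF_real) auto

lemma lim_inf_rat: "x \<in> \<rat> \<Longrightarrow> 0 \<le> x \<Longrightarrow> (\<lambda>n. f n x) \<longlonglongrightarrow> lim_inf x"
  using conv lim_inf_eqI by (auto simp: convergent_def)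

lemma log_concave_on_lim_inf: "log_concave_on {0..} lim_inf"
proof -
  have ineq: "lim_inf x powr l * lim_inf y powr (1 - l) \<le> lim_inf (l * x + (1 - l) * y)"
    if xy: "0 \<le> x" "0 \<le> y" and l: "0 < l" "l < 1" for x y l
  proof (rule LIMSEQ_le[OF _ tail_inf_tendsto])
    show "(\<lambda>n. tail_inf n x powr l * tail_inf n y powr (1 - l)) \<longlonglongrightarrow> lim_inf x powr l * lim_inf y powr (1 - l)"
      using l tail_inf_nonneg by (intro tendsto_mult tendsto_powr2 tail_inf_tendsto tendsto_const) auto
    have "tail_inf n x powr l * tail_inf n y powr (1 - l) \<le> tail_inf n (l * x + (1 - l) * y)" for n
    proof (rule tail_inf_greatest)
      fix m assume "n \<le> m"
      then have "tail_inf n x powr l * tail_inf n y powr (1 - l) \<le> f m x powr l * f m y powr (1 - l)"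
        using l by (intro mult_mono powr_mono2 tail_inf_le tail_inf_nonneg) auto
      also have "\<dots> \<le> f m (l * x + (1 - l) * y)" by (rule log_concave_onD[OF lc xy l])
      finally show "tail_inf n x powr l * tail_inf n y powr (1 - l) \<le> f m (l * x + (1 - l) * y)" .
    qed
    then show "\<exists>N. \<forall>n\<ge>N. tail_inf n x powr l * tail_inf n y powr (1 - l) \<le> tail_inf n (l * x + (1 - l) * y)" by blast
  qed
  show ?thesis unfolding log_concave_on_def
  proof (intro conjI ballI)
    show "0 \<le> lim_inf x" for x by (rule lim_inf_nonneg)
    show "lim_inf x powr l * lim_inf y powr (1 - l) \<le> lim_inf (l *\<^sub>R x + (1 - l) *\<^sub>R y)"
      if "x \<in> {0..}" "y \<in> {0..}" "l \<in> {0<..<1}" for x y l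
      using ineq[of x y l] that by simp
  qed simp
qed

definition pos_set :: "real set" where "pos_set = {x. 0 \<le> x \<and> 0 < lim_inf x}"

lemma q_in_pos_set: "q \<in> pos_set"
proof -
  have "c \<le> lim_inf q" by (rule LIMSEQ_le_const[OF tail_inf_tendsto]) (use tail_inf_greatest c in blast)
  then show ?thesis using q c by (simp add: pos_set_def)
qed

lemma convex_pos_set: "convex pos_set"
  unfolding convex_alt
proof (intro ballI allI impI)
  fix x y u assume xy: "x \<in> pos_set" "y \<in> pos_set" and u: "0 \<le> u \<and> u \<le> (1::real)"
  show "(1 - u) *\<^sub>R x + u *\<^sub>R y \<in> pos_set"
  proof (cases "u = 0 \<or> u = 1")
    case True
    then show ?thesis using xy by auto
  next
    case False
    then have u': "0 < 1 - u" "1 - u < 1" using u by auto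
    have "0 < lim_inf x powr (1 - u) * lim_inf y powr (1 - (1 - u))" using xy by (simp add: pos_set_def)
    also have "\<dots> \<le> lim_inf ((1 - u) * x + (1 - (1 - u)) * y)"
      using xy by (intro log_concave_onD[OF log_concave_on_lim_inf _ _ u']) (auto simp: pos_set_def)
    finally show ?thesis using xy u by (simp add: pos_set_def)
  qed
qed

lemma continuous_on_lim_inf: "continuous_on (interior pos_set) lim_inf"
proof -
  have pos: "0 \<le> x" "0 < lim_inf x" if "x \<in> interior pos_set" for x
    using that interior_subset[of pos_set] by (auto simp: pos_set_def)
  have "convex_on (interior pos_set) (\<lambda>x. - ln (lim_inf x))"
  proof (rule convex_onI)
    show "convex (interior pos_set)" by (rule convex_interior[OF convex_pos_set])
    fix t x y :: real assume t: "0 < t" "t < 1" and xy: "x \<in> interior pos_set" "y \<in> interior pos_set"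
    have t': "0 < 1 - t" "1 - t < 1" using t by auto
    note p = pos[OF xy(1)] pos[OF xy(2)]
    have "exp ((1 - t) * ln (lim_inf x) + t * ln (lim_inf y)) = lim_inf x powr (1 - t) * lim_inf y powr (1 - (1 - t))"
      using p by (simp add: powr_def exp_add)
    also have "\<dots> \<le> lim_inf ((1 - t) * x + (1 - (1 - t)) * y)"
      by (rule log_concave_onD[OF log_concave_on_lim_inf p(1) p(3) t'])
    finally have le: "exp ((1 - t) * ln (lim_inf x) + t * ln (lim_inf y)) \<le> lim_inf ((1 - t) * x + t * y)" by simp
    then have "0 < lim_inf ((1 - t) * x + t * y)" by (rule less_le_trans[OF exp_gt_zero])
    then have "(1 - t) * ln (lim_inf x) + t * ln (lim_inf y) \<le> ln (lim_inf ((1 - t) * x + t * y))"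
      using le by (simp only: ln_ge_iff)
    then show "- ln (lim_inf ((1 - t) *\<^sub>R x + t *\<^sub>R y)) \<le> (1 - t) * - ln (lim_inf x) + t * - ln (lim_inf y)"
      by simp
  qed
  then have "continuous_on (interior pos_set) (\<lambda>x. exp (- (- ln (lim_inf x))))"
    by (intro continuous_on_exp continuous_on_minus convex_on_continuous[OF open_interior])
  then show ?thesis
    by (rule continuous_on_eq) (use pos in auto)
qed

text \<open>
  The tool for upper estimates: if the functions are large at \<open>x\<close> infinitely often and bounded below
  at \<open>a\<close>, then log-concavity makes the limit large at each rational point between them.
\<close>
lemma limit_lower_bound:
  assumes freq: "\<exists>\<^sub>F n in sequentially. K \<le> f n x" and K: "0 < K"
    and a: "0 \<le> a" "\<forall>\<^sub>F n in sequentially. \<alpha> \<le> f n a" "0 < \<alpha>"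
    and x: "0 \<le> x" and l: "0 < l" "l < 1" and rat: "l * a + (1 - l) * x \<in> \<rat>"
  shows "\<alpha> powr l * K powr (1 - l) \<le> lim_inf (l * a + (1 - l) * x)"
proof (rule ccontr)
  let ?y = "l * a + (1 - l) * x"
  assume "\<not> \<alpha> powr l * K powr (1 - l) \<le> lim_inf ?y"
  moreover have "(\<lambda>n. f n ?y) \<longlonglongrightarrow> lim_inf ?y" using rat a x l by (intro lim_inf_rat) auto
  ultimately have "\<forall>\<^sub>F n in sequentially. f n ?y < \<alpha> powr l * K powr (1 - l)"
    by (intro order_tendstoD(2)) auto
  then have "\<forall>\<^sub>F n in sequentially. \<not> K \<le> f n x"
    using a(2)
  proof eventually_elim
    case (elim n)
    show ?case
    proof
      assume "K \<le> f n x"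
      then have "\<alpha> powr l * K powr (1 - l) \<le> f n a powr l * f n x powr (1 - l)"
        using elim K a(3) l by (intro mult_mono powr_mono2) auto
      also have "\<dots> \<le> f n ?y" by (rule log_concave_onD[OF lc a(1) x l])
      finally show False using elim by simp
    qed
  qed
  then show False using freq by (simp add: frequently_def)
qed

lemma between_as_combination:
  fixes a x y :: real
  assumes "a < y \<and> y < x \<or> x < y \<and> y < a"
  defines "l \<equiv> (x - y) / (x - a)"
  shows "0 < l" "l < 1" "l * a + (1 - l) * x = y"
proof -
  have "l * (x - a) = x - y" using assms by (auto simp: l_def)
  then show "l * a + (1 - l) * x = y" by (simp add: algebra_simps)
qed (use assms in \<open>auto simp: l_def divide_simps\<close>)

text \<open>
  If the values at \<open>x\<close> exceeded \<open>K > lim_inf x\<close> infinitely often, then the lower limit at rationals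
  approaching \<open>x\<close> would be asymptotically at least \<open>K\<close>, contradicting its continuity.
\<close>
lemma eventually_less_interior:
  assumes x: "x \<in> interior pos_set" and K: "lim_inf x < K"
  shows "\<forall>\<^sub>F n in sequentially. f n x < K"
proof (rule ccontr)
  assume "\<not> ?thesis"
  then have freq: "\<exists>\<^sub>F n in sequentially. K \<le> f n x" by (simp add: frequently_def not_le)
  obtain e where e: "0 < e" "ball x e \<subseteq> interior pos_set" using x open_interior openE by metis
  have xP: "0 \<le> x" "0 < lim_inf x" using x interior_subset[of pos_set] by (auto simp: pos_set_def)
  define a where "a = x - e / 2"
  have "a \<in> ball x e" using e by (simp add: a_def dist_real_def)
  then have aP: "0 \<le> a" "0 < lim_inf a" using e interior_subset[of pos_set] by (auto simp: pos_set_def)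
  have ax: "a < x" using e by (simp add: a_def)
  define \<alpha> where "\<alpha> = lim_inf a / 2"
  have \<alpha>: "0 < \<alpha>" "\<forall>\<^sub>F n in sequentially. \<alpha> \<le> f n a"
    using aP eventually_gt[of \<alpha> a] by (auto simp: \<alpha>_def elim: eventually_mono)
  have "\<exists>y. max a (x - 1 / real (Suc j)) < y \<and> y < x \<and> y \<in> \<rat>" for j
    using Rats_dense_in_real[of "max a (x - 1 / real (Suc j))" x] ax by auto
  then obtain y where y: "\<And>j. max a (x - 1 / real (Suc j)) < y j" "\<And>j. y j < x" "\<And>j. y j \<in> \<rat>" by metis
  have "y \<longlonglongrightarrow> x"
  proof (rule tendsto_sandwich)
    show "(\<lambda>j. x - 1 / real (Suc j)) \<longlonglongrightarrow> x"
      using tendsto_diff[OF tendsto_const LIMSEQ_Suc[OF lim_1_over_n], of x] by simp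
    show "\<forall>\<^sub>F j in sequentially. x - 1 / real (Suc j) \<le> y j" using y(1) by (intro always_eventually) (auto simp: less_imp_le)
    show "\<forall>\<^sub>F j in sequentially. y j \<le> x" using y(2) by (intro always_eventually) (auto simp: less_imp_le)
  qed simp
  define l where "l j = (x - y j) / (x - a)" for j
  have l: "0 < l j" "l j < 1" "l j * a + (1 - l j) * x = y j" for j
    unfolding l_def using between_as_combination[of a "y j" x] y[of j] by auto
  have "\<alpha> powr l j * K powr (1 - l j) \<le> lim_inf (y j)" for j
    using limit_lower_bound[OF freq _ aP(1) \<alpha>(2,1) xP(1) l(1,2), of j] l(3)[of j] y(3)[of j] K xP by simp
  moreover have "(\<lambda>j. \<alpha> powr l j * K powr (1 - l j)) \<longlonglongrightarrow> \<alpha> powr 0 * K powr (1 - 0)"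
  proof -
    have "l \<longlonglongrightarrow> (x - x) / (x - a)" unfolding l_def using \<open>y \<longlonglongrightarrow> x\<close> ax by (intro tendsto_intros) auto
    then have "l \<longlonglongrightarrow> 0" by simp
    then show ?thesis using \<alpha> K xP by (intro tendsto_intros) auto
  qed
  moreover have "(\<lambda>j. lim_inf (y j)) \<longlonglongrightarrow> lim_inf x"
    using continuous_on_lim_inf x \<open>y \<longlonglongrightarrow> x\<close> continuous_on_eq_continuous_at[OF open_interior]
    by (intro isCont_tendsto_compose[of x lim_inf]) auto
  ultimately have "\<alpha> powr 0 * K powr (1 - 0) \<le> lim_inf x" by (intro LIMSEQ_le) auto
  then show False using \<alpha> K xP by simp
qed

text \<open>
  A value bounded away from 0 outside the closure would make the lower limit positive at rationals
  between that point and \<open>q\<close>, some of which still lie outside \<open>pos_set\<close>.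
\<close>
lemma eventually_less_exterior:
  assumes x: "0 \<le> x" "x \<notin> closure pos_set" and K: "0 < K"
  shows "\<forall>\<^sub>F n in sequentially. f n x < K"
proof (rule ccontr)
  assume "\<not> ?thesis"
  then have freq: "\<exists>\<^sub>F n in sequentially. K \<le> f n x" by (simp add: frequently_def not_le)
  have "open (- closure pos_set)" by (intro open_Compl closed_closure)
  then obtain e where e: "0 < e" "ball x e \<subseteq> - closure pos_set" using x by (meson ComplI openE)
  have "x \<noteq> q" using x q_in_pos_set closure_subset by blast
  then have "\<exists>y. (q < y \<and> y < x \<or> x < y \<and> y < q) \<and> \<bar>x - y\<bar> < e \<and> y \<in> \<rat>"
    using Rats_dense_in_real[of "max q (x - e)" x] Rats_dense_in_real[of x "min q (x + e)"] e
    by (cases "q < x") (auto simp: abs_if, (smt (verit))+)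
  then obtain y where y: "q < y \<and> y < x \<or> x < y \<and> y < q" "\<bar>x - y\<bar> < e" "y \<in> \<rat>" by blast
  define l where "l = (x - y) / (x - q)"
  have l: "0 < l" "l < 1" "l * q + (1 - l) * x = y"
    unfolding l_def using between_as_combination[OF y(1)] by auto
  have "y \<in> ball x e" using y by (simp add: dist_real_def)
  then have "y \<notin> pos_set" using e closure_subset by blast
  moreover have "0 \<le> y" using y(1) x q by auto
  ultimately have "lim_inf y \<le> 0" by (simp add: pos_set_def)
  moreover have "c powr l * K powr (1 - l) \<le> lim_inf (l * q + (1 - l) * x)"
    using c y(3) l(3) by (intro limit_lower_bound[OF freq K q _ _ x(1) l(1,2)]) auto
  moreover have "0 < c powr l * K powr (1 - l)" using c K by simp
  ultimately show False using l(3) by simp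
qed

lemma tendsto_off_frontier:
  assumes "x \<notin> frontier pos_set"
  shows "(\<lambda>n. f n x) \<longlonglongrightarrow> lim_inf x"
proof (cases "0 \<le> x")
  case False
  then have "(\<lambda>n. f n x) \<longlonglongrightarrow> 0" using zero by simp
  then show ?thesis using lim_inf_eqI by metis
next
  case True
  show ?thesis
  proof (rule order_tendstoI)
    show "\<forall>\<^sub>F n in sequentially. y < f n x" if "y < lim_inf x" for y using that by (rule eventually_gt)
    show "\<forall>\<^sub>F n in sequentially. f n x < y" if "lim_inf x < y" for y
      using assms eventually_less_interior[OF _ that] eventually_less_exterior[OF True, of y] that lim_inf_nonneg[of x]
      by (auto simp: frontier_def)
  qed
qed

text \<open>
  The exceptional points lie on the boundary of an interval.
\<close>
lemma tendsto_AE: "AE x in lborel. (\<lambda>n. f n x) \<longlonglongrightarrow> lim_inf x"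
proof -
  have "frontier pos_set \<in> null_sets lborel"
  proof -
    have "negligible (frontier pos_set)" by (rule negligible_convex_frontier[OF convex_pos_set])
    then show ?thesis by (simp add: negligible_iff_null_sets null_sets_completion_iff)
  qed
  then have "AE x in lborel. x \<notin> frontier pos_set" by (rule AE_not_in)
  then show ?thesis by eventually_elim (rule tendsto_off_frontier)
qed

lemma laplace_tendsto:
  assumes s: "0 < s"
  shows "integrable lborel (\<lambda>x. exp (- s * x) * lim_inf x)"
    and "(\<lambda>n. \<integral>x. exp (- s * x) * f n x \<partial>lborel) \<longlonglongrightarrow> (\<integral>x. exp (- s * x) * lim_inf x \<partial>lborel)"
proof -
  have iw: "integrable lborel (\<lambda>x. M / s * erlang_density 0 s x)"
    by (intro integrable_mult_right erlang_0_integral s)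
  have AEl: "AE x in lborel. (\<lambda>n. exp (- s * x) * f n x) \<longlonglongrightarrow> exp (- s * x) * lim_inf x"
    using tendsto_AE by eventually_elim (intro tendsto_mult tendsto_const)
  have bd: "norm (exp (- s * x) * f n x) \<le> M / s * erlang_density 0 s x" for n x
  proof (cases "0 \<le> x")
    case True
    have "exp (- s * x) * f n x \<le> exp (- s * x) * M" using bounds by (intro mult_left_mono) auto
    then show ?thesis using True s bounds by (simp add: erlang_density_def abs_mult mult.commute)
  qed (simp add: zero erlang_density_def)
  have bd': "AE x in lborel. norm (exp (- s * x) * f n x) \<le> M / s * erlang_density 0 s x" for n
    using bd by (intro AE_I2)
  show "integrable lborel (\<lambda>x. exp (- s * x) * lim_inf x)"
    by (rule integrable_dominated_convergence[OF _ _ iw AEl bd']) measurable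
  show "(\<lambda>n. \<integral>x. exp (- s * x) * f n x \<partial>lborel) \<longlonglongrightarrow> (\<integral>x. exp (- s * x) * lim_inf x \<partial>lborel)"
    by (rule integral_dominated_convergence[OF _ _ iw AEl bd']) measurable
qed

lemma lim_inf_zero: "x < 0 \<Longrightarrow> lim_inf x = 0"
  using lim_inf_eqI[of x 0] zero by simp

end

context log_concave_laplace_limit
begin

text \<open>
  The two points at which the functions stay above \<open>c\<close> give a uniform bound; a diagonal subsequence
  then converges at all rationals.
\<close>
lemma spread_limit:
  assumes qr: "0 \<le> q" "q < r" and c: "0 < c"
    and freq: "\<exists>\<^sub>F n in sequentially. c \<le> h n q \<and> c \<le> h n r"
  shows "\<exists>g. g \<in> borel_measurable borel \<and> log_concave_on {0..} g \<and> (\<forall>x<0. g x = 0) \<and>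
    (\<forall>s>0. integrable lborel (\<lambda>x. exp (- s * x) * g x) \<and> \<phi> s = (\<integral>x. exp (- s * x) * g x \<partial>lborel))"
proof -
  have "infinite {n. c \<le> h n q \<and> c \<le> h n r}"
    using freq by (simp add: cofinite_eq_sequentially[symmetric] frequently_cofinite)
  from infinite_enumerate[OF this] obtain \<sigma> :: "nat \<Rightarrow> nat"
    where \<sigma>: "strict_mono \<sigma>" "\<And>n. c \<le> h (\<sigma> n) q" "\<And>n. c \<le> h (\<sigma> n) r" by auto
  define M where "M = max c (16 * C\<^sup>2 / (c * (r - q)\<^sup>2))"
  have hM: "h (\<sigma> n) x \<le> M" for n x
  proof (cases "0 \<le> x")
    case True
    then show ?thesis unfolding M_def
      by (intro log_concave_on_bounded_by_mass[OF lc nonneg int mass qr c \<sigma>(2,3)])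
  qed (use zero c in \<open>simp add: M_def\<close>)
  obtain \<rho> :: "nat \<Rightarrow> nat" where \<rho>: "strict_mono \<rho>" "\<And>x. x \<in> \<rat> \<Longrightarrow> \<exists>l. (\<lambda>n. h (\<sigma> (\<rho> n)) x) \<longlonglongrightarrow> l"
    using function_convergent_subsequence[OF countable_rat, of "\<lambda>n. h (\<sigma> n)" M] hM nonneg by auto
  define f where "f n = h (\<sigma> (\<rho> n))" for n
  interpret f: log_concave_pointwise_limit f M q c
  proof
    show "convergent (\<lambda>n. f n x)" if "x \<in> \<rat>" "0 \<le> x" for x
      using \<rho>(2)[OF that(1)] by (simp only: f_def convergent_def)
  qed (simp_all only: f_def measurable_h lc zero nonneg hM qr(1) c \<sigma>(2))
  have sub: "filterlim (\<lambda>n. \<sigma> (\<rho> n)) sequentially sequentially"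
    using filterlim_subseq[OF strict_mono_o[OF \<sigma>(1) \<rho>(1)]] by (simp add: o_def)
  have "\<phi> s = (\<integral>x. exp (- s * x) * f.lim_inf x \<partial>lborel)" if s: "0 < s" for s
  proof (rule LIMSEQ_unique[OF _ f.laplace_tendsto(2)[OF s]])
    show "(\<lambda>n. \<integral>x. exp (- s * x) * f n x \<partial>lborel) \<longlonglongrightarrow> \<phi> s"
      unfolding f_def by (rule filterlim_compose[OF lap[OF s] sub])
  qed
  then show ?thesis
    using f.measurable_lim_inf f.log_concave_on_lim_inf f.lim_inf_zero f.laplace_tendsto(1) by (intro exI[of _ f.lim_inf]) blast
qed

theorem limit_dichotomy:
  assumes pos: "0 < \<phi> 1" "0 < \<phi> 2"
  shows "(\<exists>c x0. 0 \<le> c \<and> 0 \<le> x0 \<and> (\<forall>s>0. \<phi> s = c * exp (- s * x0))) \<or>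
    (\<exists>g. g \<in> borel_measurable borel \<and> log_concave_on {0..} g \<and> (\<forall>x<0. g x = 0) \<and>
      (\<forall>s>0. integrable lborel (\<lambda>x. exp (- s * x) * g x) \<and> \<phi> s = (\<integral>x. exp (- s * x) * g x \<partial>lborel)))"
proof (cases "\<exists>q r c. 0 \<le> q \<and> q < r \<and> 0 < c \<and> (\<exists>\<^sub>F n in sequentially. c \<le> h n q \<and> c \<le> h n r)")
  case True
  then obtain q r c where "0 \<le> q" "q < r" "0 < c" "\<exists>\<^sub>F n in sequentially. c \<le> h n q \<and> c \<le> h n r" by blast
  from spread_limit[OF this] show ?thesis by (rule disjI2)
next
  case False
  have "\<forall>\<^sub>F n in sequentially. \<not> (c \<le> h n q \<and> c \<le> h n r)" if "0 \<le> q" "q < r" "0 < c" for q r c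
    using False that unfolding frequently_def by blast
  from concentrated_limit[OF this pos] show ?thesis by (rule disjI1)
qed

end

section \<open>Representing functions with log-concave Taylor sequences\<close>

lemma completely_monotone_of_taylor_seq_nonneg:
  assumes diff: "\<And>n. (deriv ^^ n) \<phi> differentiable_on {0<..}"
    and nn: "\<And>t n. 0 < t \<Longrightarrow> 0 \<le> taylor_seq \<phi> t n"
  shows "completely_monotone_family (\<lambda>n t. (- 1) ^ n * (deriv ^^ n) \<phi> t)"
proof
  fix t :: real and n :: nat assume t: "0 < t"
  show "0 \<le> (- 1) ^ n * (deriv ^^ n) \<phi> t"
    using nn[OF t, of n] fact_gt_zero[of n, where 'a = real] by (simp add: taylor_seq_def zero_le_divide_iff not_le)
  have "(deriv ^^ n) \<phi> differentiable (at t)"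
    using diff[of n] t by (simp add: differentiable_on_def at_within_open[of _ "{0<..}"])
  then have "((deriv ^^ n) \<phi> has_real_derivative (deriv ^^ Suc n) \<phi> t) (at t)"
    by (simp add: DERIV_deriv_iff_real_differentiable)
  from DERIV_cmult[OF this, of "(- 1) ^ n"]
  show "((\<lambda>t. (- 1) ^ n * (deriv ^^ n) \<phi> t) has_real_derivative - ((- 1) ^ Suc n * (deriv ^^ Suc n) \<phi> t)) (at t)"
    by simp
qed

locale log_concave_taylor =
  fixes \<phi> :: "real \<Rightarrow> real"
  assumes cont: "continuous_on {0..} \<phi>"
    and diff: "\<And>n. (deriv ^^ n) \<phi> differentiable_on {0<..}"
    and lcs: "\<And>t. 0 < t \<Longrightarrow> log_concave_seq (taylor_seq \<phi> t)"
begin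

lemma pf2: "0 < t \<Longrightarrow> pf2_seq (taylor_seq \<phi> t)"
  using lcs log_concave_seq_imp_pf2_seq by blast

lemma taylor_nonneg: "0 < t \<Longrightarrow> 0 \<le> taylor_seq \<phi> t n"
  using pf2 pf2_seqD(1) by blast

lemma taylor_sums:
  assumes "0 < s" "s \<le> t"
  shows "(\<lambda>j. taylor_seq \<phi> t j * (t - s) ^ j) sums \<phi> s"
proof -
  interpret completely_monotone_family "\<lambda>n t. (- 1) ^ n * (deriv ^^ n) \<phi> t"
    using diff taylor_nonneg by (rule completely_monotone_of_taylor_seq_nonneg)
  show ?thesis using taylor_sums[OF assms, of 0] by (simp add: taylor_seq_def)
qed

lemma tendsto_at_0:
  assumes "x \<longlonglongrightarrow> 0" "\<And>n. 0 \<le> x n"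
  shows "(\<lambda>n. \<phi> (x n)) \<longlonglongrightarrow> \<phi> 0"
  using continuous_on_tendsto_compose[OF cont assms(1)] assms(2) by simp

text \<open>
  The Taylor series is only known to represent \<open>\<phi>\<close> at positive arguments; the bound at 0 follows by
  continuity for each partial sum.
\<close>
lemma sum_taylor_le:
  assumes t: "0 < t"
  shows "(\<Sum>j<n. taylor_seq \<phi> t j * t ^ j) \<le> \<phi> 0"
proof -
  define x where "x i = t / real (Suc i)" for i
  have x: "0 < x i" "x i \<le> t" for i
    using t by (auto simp: x_def divide_le_eq intro: mult_left_le)
  have x0: "x \<longlonglongrightarrow> 0"
    unfolding x_def by (rule LIMSEQ_Suc[OF lim_const_over_n])
  have "(\<lambda>i. \<Sum>j<n. taylor_seq \<phi> t j * (t - x i) ^ j) \<longlonglongrightarrow> (\<Sum>j<n. taylor_seq \<phi> t j * (t - 0) ^ j)"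
    by (intro tendsto_intros x0)
  moreover have "(\<lambda>i. \<phi> (x i)) \<longlonglongrightarrow> \<phi> 0" by (rule tendsto_at_0[OF x0 less_imp_le[OF x(1)]])
  moreover have "(\<Sum>j<n. taylor_seq \<phi> t j * (t - x i) ^ j) \<le> \<phi> (x i)" for i
  proof -
    note S = taylor_sums[OF x, of i]
    have "0 \<le> taylor_seq \<phi> t j * (t - x i) ^ j" for j
      using taylor_nonneg[OF t] x[of i] by (intro mult_nonneg_nonneg zero_le_power) auto
    then have "(\<Sum>j<n. taylor_seq \<phi> t j * (t - x i) ^ j) \<le> (\<Sum>j. taylor_seq \<phi> t j * (t - x i) ^ j)"
      by (intro sum_le_suminf sums_summable[OF S]) auto
    then show ?thesis by (simp only: sums_unique[OF S, symmetric])
  qed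
  ultimately have "(\<Sum>j<n. taylor_seq \<phi> t j * (t - 0) ^ j) \<le> \<phi> 0" by (intro LIMSEQ_le) auto
  then show ?thesis by simp
qed

lemma summable_taylor:
  assumes t: "0 < t"
  shows "summable (\<lambda>j. taylor_seq \<phi> t j * t ^ j)" "(\<Sum>j. taylor_seq \<phi> t j * t ^ j) \<le> \<phi> 0"
proof -
  have "0 \<le> taylor_seq \<phi> t j * t ^ j" for j using taylor_nonneg[OF t] t by simp
  then show "summable (\<lambda>j. taylor_seq \<phi> t j * t ^ j)"
    by (rule summableI_nonneg_bounded) (rule sum_taylor_le[OF t])
  then show "(\<Sum>j. taylor_seq \<phi> t j * t ^ j) \<le> \<phi> 0"
    by (rule suminf_le_const) (rule sum_taylor_le[OF t])
qed

text \<open>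
  A zero \<open>t0\<close> of \<open>\<phi>\<close> makes all Taylor coefficients at a later point \<open>t\<close> vanish, because the series at \<open>t0\<close> has
  nonnegative terms and sum 0.
\<close>
lemma zero_somewhere_imp_zero:
  assumes t0: "0 < t0" "\<phi> t0 = 0" and s: "0 < s"
  shows "\<phi> s = 0"
proof -
  define t where "t = max s t0 + 1"
  have t: "0 < t" "t0 < t" "s \<le> t" using t0 by (auto simp: t_def)
  have S: "(\<lambda>j. taylor_seq \<phi> t j * (t - t0) ^ j) sums 0" using taylor_sums[of t0 t] t t0 by simp
  have "taylor_seq \<phi> t j = 0" for j
  proof -
    have nn: "0 \<le> taylor_seq \<phi> t i * (t - t0) ^ i" for i using taylor_nonneg[OF t(1)] t by simp
    have "(\<Sum>j. taylor_seq \<phi> t j * (t - t0) ^ j) = 0" using S by (rule sums_unique[symmetric])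
    then have "\<forall>j. taylor_seq \<phi> t j * (t - t0) ^ j = 0"
      using suminf_eq_zero_iff[OF sums_summable[OF S] nn] by blast
    then show ?thesis using t by simp
  qed
  then have "(\<lambda>j. 0) sums \<phi> s" using taylor_sums[OF s t(3)] by simp
  then show ?thesis using sums_unique2 sums_zero by blast
qed

text \<open>
  The rate is \<open>N + 1\<close> rather than \<open>N\<close>, so that it is positive for every \<open>N\<close>.
\<close>
definition smoothing :: "nat \<Rightarrow> real \<Rightarrow> real" where
  "smoothing N x = (if 0 \<le> x then gamma_mixture (taylor_seq \<phi> (real (Suc N))) (real (Suc N)) x else 0)"

lemma smoothing_measurable [measurable]: "smoothing N \<in> borel_measurable borel"
proof -
  have [measurable]: "gamma_mixture (taylor_seq \<phi> (real (Suc N))) (real (Suc N)) \<in> borel_measurable borel"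
    by (intro borel_measurable_gamma_mixture taylor_nonneg summable_taylor) simp_all
  show ?thesis unfolding smoothing_def[abs_def] by measurable
qed

lemma log_concave_on_smoothing: "log_concave_on {0..} (smoothing N)"
proof -
  have "log_concave_on {0..} (gamma_mixture (taylor_seq \<phi> (real (Suc N))) (real (Suc N)))"
    by (intro log_concave_on_gamma_mixture pf2 summable_taylor) simp_all
  then show ?thesis by (auto simp: log_concave_on_def smoothing_def)
qed

lemma smoothing_nonneg: "0 \<le> smoothing N x"
  using log_concave_on_smoothing[of N] by (cases "0 \<le> x") (auto simp: log_concave_on_def smoothing_def)

lemma has_bochner_integral_smoothing:
  fixes N :: nat
  assumes s: "0 \<le> s"
  defines "r \<equiv> real (Suc N)"
  shows "has_bochner_integral lborel (\<lambda>x. exp (- s * x) * smoothing N x)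
    (r / (r + s) * (\<Sum>n. taylor_seq \<phi> r n * (r\<^sup>2 / (r + s)) ^ n))"
proof (rule has_bochner_integral_nn_integral)
  have r: "0 < r" by (simp add: r_def)
  have q: "0 \<le> r\<^sup>2 / (r + s)" "r\<^sup>2 / (r + s) \<le> r"
    using r s by (auto simp: power2_eq_square divide_le_eq)
  have "summable (\<lambda>n. taylor_seq \<phi> r n * (r\<^sup>2 / (r + s)) ^ n)"
  proof (rule summable_comparison_test[OF _ summable_taylor(1)[OF r]], intro exI allI impI)
    fix n
    show "norm (taylor_seq \<phi> r n * (r\<^sup>2 / (r + s)) ^ n) \<le> taylor_seq \<phi> r n * r ^ n"
    proof -
      have "taylor_seq \<phi> r n * (r\<^sup>2 / (r + s)) ^ n \<le> taylor_seq \<phi> r n * r ^ n"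
        by (intro mult_left_mono power_mono q taylor_nonneg r)
      then show ?thesis
        using mult_nonneg_nonneg[OF taylor_nonneg[OF r, of n] zero_le_power[OF q(1), of n]]
        by (simp only: real_norm_def abs_of_nonneg)
    qed
  qed
  then show "0 \<le> r / (r + s) * (\<Sum>n. taylor_seq \<phi> r n * (r\<^sup>2 / (r + s)) ^ n)"
    using r s q taylor_nonneg[OF r] by (intro mult_nonneg_nonneg suminf_nonneg) auto
  have "(\<integral>\<^sup>+x. ennreal (exp (- s * x) * smoothing N x) \<partial>lborel)
     = (\<integral>\<^sup>+x. ennreal (exp (- s * x) * gamma_mixture (taylor_seq \<phi> r) r x) * indicator {0..} x \<partial>lborel)"
    by (intro nn_integral_cong) (auto simp: smoothing_def r_def split: split_indicator)
  also have "\<dots> = ennreal (r / (r + s) * (\<Sum>n. taylor_seq \<phi> r n * (r\<^sup>2 / (r + s)) ^ n))"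
    by (rule laplace_gamma_mixture[OF taylor_nonneg[OF r] r summable_taylor(1)[OF r] s])
  finally show "(\<integral>\<^sup>+x. ennreal (exp (- s * x) * smoothing N x) \<partial>lborel)
     = ennreal (r / (r + s) * (\<Sum>n. taylor_seq \<phi> r n * (r\<^sup>2 / (r + s)) ^ n))" .
qed (simp_all add: smoothing_nonneg)

lemma laplace_smoothing:
  assumes s: "0 < s"
  defines "r \<equiv> \<lambda>N. real (Suc N)"
  shows "(\<integral>x. exp (- s * x) * smoothing N x \<partial>lborel) = r N / (r N + s) * \<phi> (s * (r N / (r N + s)))"
proof -
  have r: "0 < r N" by (simp add: r_def)
  have pos: "0 < s * (r N / (r N + s))" using r s by simp
  have le: "s * (r N / (r N + s)) \<le> r N" using r s by (simp add: divide_le_eq)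
  have eq: "r N - s * (r N / (r N + s)) = (r N)\<^sup>2 / (r N + s)"
    using r s by (simp add: divide_simps power2_eq_square) (simp add: algebra_simps)
  have "(\<integral>x. exp (- s * x) * smoothing N x \<partial>lborel)
      = r N / (r N + s) * (\<Sum>n. taylor_seq \<phi> (r N) n * ((r N)\<^sup>2 / (r N + s)) ^ n)"
    unfolding r_def by (rule has_bochner_integral_integral_eq[OF has_bochner_integral_smoothing[OF less_imp_le[OF s]]])
  moreover have "\<phi> (s * (r N / (r N + s))) = (\<Sum>n. taylor_seq \<phi> (r N) n * ((r N)\<^sup>2 / (r N + s)) ^ n)"
    using sums_unique[OF taylor_sums[OF pos le]] unfolding eq .
  ultimately show ?thesis by (simp only:)
qed

lemma laplace_smoothing_tendsto:
  assumes s: "0 < s"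
  shows "(\<lambda>N. \<integral>x. exp (- s * x) * smoothing N x \<partial>lborel) \<longlonglongrightarrow> \<phi> s"
proof -
  have q: "(\<lambda>N. real (Suc N) / (real (Suc N) + s)) \<longlonglongrightarrow> 1" using s by real_asymp
  have "continuous_on {0<..} \<phi>" using cont by (rule continuous_on_subset) auto
  then have "isCont \<phi> s" using s by (simp add: continuous_on_eq_continuous_at)
  moreover have "(\<lambda>N. s * (real (Suc N) / (real (Suc N) + s))) \<longlonglongrightarrow> s * 1"
    by (intro tendsto_mult tendsto_const q)
  ultimately have "(\<lambda>N. \<phi> (s * (real (Suc N) / (real (Suc N) + s)))) \<longlonglongrightarrow> \<phi> s"
    by (intro isCont_tendsto_compose[of s \<phi>]) simp_all
  from tendsto_mult[OF q this] show ?thesis by (simp only: laplace_smoothing[OF s] mult_1_left)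
qed

sublocale limit: log_concave_laplace_limit smoothing "\<phi> 0" \<phi>
proof
  fix N :: nat
  have *: "has_bochner_integral lborel (smoothing N) (\<Sum>n. taylor_seq \<phi> (real (Suc N)) n * real (Suc N) ^ n)"
    using has_bochner_integral_smoothing[of 0 N] by (simp add: power2_eq_square)
  show "integrable lborel (smoothing N)" using * by (simp add: has_bochner_integral_iff)
  show "(\<integral>x. smoothing N x \<partial>lborel) \<le> \<phi> 0"
    using has_bochner_integral_integral_eq[OF *] summable_taylor(2)[of "real (Suc N)"] by simp
  show "smoothing N x = 0" if "x < 0" for x using that by (simp add: smoothing_def)
  show "smoothing N \<in> borel_measurable borel" by (rule smoothing_measurable)
  show "log_concave_on {0..} (smoothing N)" by (rule log_concave_on_smoothing)
  show "(\<lambda>N. \<integral>x. exp (- s * x) * smoothing N x \<partial>lborel) \<longlonglongrightarrow> \<phi> s" if "0 < s" for s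
    using that by (rule laplace_smoothing_tendsto)
qed

text \<open>
  If \<open>\<phi>\<close> vanishes at 1 or 2, then it vanishes identically and the zero measure represents it.
\<close>
lemma positive_times_representation:
  "(\<exists>c x0. 0 \<le> c \<and> 0 \<le> x0 \<and> (\<forall>s>0. \<phi> s = c * exp (- s * x0))) \<or>
    (\<exists>g. g \<in> borel_measurable borel \<and> log_concave_on {0..} g \<and> (\<forall>x<0. g x = 0) \<and>
      (\<forall>s>0. integrable lborel (\<lambda>x. exp (- s * x) * g x) \<and> \<phi> s = (\<integral>x. exp (- s * x) * g x \<partial>lborel)))"
proof (cases "\<phi> 1 = 0 \<or> \<phi> 2 = 0")
  case True
  then have "\<phi> s = 0" if "0 < s" for s using zero_somewhere_imp_zero[OF _ _ that, of 1] zero_somewhere_imp_zero[OF _ _ that, of 2] by auto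
  then show ?thesis by (intro disjI1 exI[of _ 0]) simp
next
  case False
  have "0 \<le> \<phi> t" if "0 < t" for t using taylor_nonneg[OF that, of 0] by (simp add: taylor_seq_def)
  then have "0 \<le> \<phi> 1" "0 \<le> \<phi> 2" by simp_all
  then show ?thesis using False by (intro limit.limit_dichotomy) auto
qed

end

lemma dirac_measure_represents:
  assumes c: "0 \<le> c" "0 \<le> x0" and phi: "\<And>t. 0 \<le> t \<Longrightarrow> \<phi> t = c * exp (- t * x0)"
  shows "\<exists>\<mu> :: real measure. sets \<mu> = sets (restrict_space borel {0..}) \<and> finite_measure \<mu> \<and>
     log_concave_measure \<mu> \<and> (\<forall>t\<ge>0. \<phi> t = (\<integral>x. exp (- t * x) \<partial>\<mu>))"
proof -
  define R :: "real measure" where "R = restrict_space borel {0..}"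
  define \<mu> where "\<mu> = scale_measure (ennreal c) (return R x0)"
  have x0: "x0 \<in> space R" using c by (simp add: R_def space_restrict_space)
  have sets: "sets \<mu> = sets R" by (simp add: \<mu>_def)
  have nn: "(\<integral>\<^sup>+x. ennreal (f x) \<partial>\<mu>) = ennreal (c * f x0)" if f: "f \<in> borel_measurable R" "0 \<le> f x0" for f
  proof -
    have m: "(\<lambda>x. ennreal (f x)) \<in> borel_measurable R" using f(1) by measurable
    have "(\<integral>\<^sup>+x. ennreal (f x) \<partial>\<mu>) = ennreal c * (\<integral>\<^sup>+x. ennreal (f x) \<partial>return R x0)"
      unfolding \<mu>_def using m by (intro nn_integral_scale_measure) simp
    also have "(\<integral>\<^sup>+x. ennreal (f x) \<partial>return R x0) = ennreal (f x0)"
      by (rule nn_integral_return[OF x0 m])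
    finally show ?thesis using c f by (simp add: ennreal_mult)
  qed
  have "\<phi> t = (\<integral>x. exp (- t * x) \<partial>\<mu>)" if "0 \<le> t" for t
  proof -
    have m: "(\<lambda>x. exp (- t * x)) \<in> borel_measurable R" unfolding R_def by (intro measurable_restrict_space1) measurable
    then have m': "(\<lambda>x. exp (- t * x)) \<in> borel_measurable \<mu>" using measurable_cong_sets[OF sets refl] by blast
    have "has_bochner_integral \<mu> (\<lambda>x. exp (- t * x)) (c * exp (- t * x0))"
      using c by (intro has_bochner_integral_nn_integral m' nn[OF m]) auto
    then show ?thesis using phi[OF that] by (simp add: has_bochner_integral_integral_eq)
  qed
  moreover have "finite_measure \<mu>"
  proof (rule finite_measureI)
    have "emeasure \<mu> (space \<mu>) = (\<integral>\<^sup>+x. ennreal 1 \<partial>\<mu>)" by simp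
    also have "\<dots> = ennreal (c * 1)" by (rule nn) auto
    finally show "emeasure \<mu> (space \<mu>) \<noteq> \<infinity>" by simp
  qed
  moreover have "log_concave_measure \<mu>"
    unfolding log_concave_measure_def \<mu>_def R_def using c by blast
  ultimately show ?thesis using sets unfolding R_def by blast
qed

lemma density_measure_represents:
  assumes g: "g \<in> borel_measurable borel" "log_concave_on {0..} g"
    and int: "\<And>t. 0 \<le> t \<Longrightarrow> has_bochner_integral lborel (\<lambda>x. exp (- t * x) * g x) (\<phi> t)"
    and zero: "\<And>x. x < 0 \<Longrightarrow> g x = 0"
  shows "\<exists>\<mu> :: real measure. sets \<mu> = sets (restrict_space borel {0..}) \<and> finite_measure \<mu> \<and>
     log_concave_measure \<mu> \<and> (\<forall>t\<ge>0. \<phi> t = (\<integral>x. exp (- t * x) \<partial>\<mu>))"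
proof -
  define R :: "real measure" where "R = restrict_space lborel {0..}"
  define \<mu> where "\<mu> = density R (\<lambda>x. ennreal (g x))"
  have setsR: "sets R = sets (restrict_space borel {0..})"
    unfolding R_def by (intro sets_restrict_space_cong) simp
  have sets: "sets \<mu> = sets R" by (simp add: \<mu>_def)
  have g0: "0 \<le> g x" for x using g(2) zero[of x] by (cases "0 \<le> x") (auto simp: log_concave_on_def)
  have mR: "f \<in> borel_measurable R" if "f \<in> borel_measurable borel" for f :: "real \<Rightarrow> ennreal"
    unfolding R_def using that by (intro measurable_restrict_space1) simp
  have nn: "(\<integral>\<^sup>+x. ennreal (exp (- t * x)) \<partial>\<mu>) = ennreal (\<phi> t)" if t: "0 \<le> t" for t
  proof -
    have gm: "(\<lambda>x. ennreal (g x)) \<in> borel_measurable R" using g(1) by (intro mR) measurable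
    have em: "(\<lambda>x. ennreal (exp (- t * x))) \<in> borel_measurable R" by (intro mR) measurable
    have "(\<integral>\<^sup>+x. ennreal (exp (- t * x)) \<partial>\<mu>) = (\<integral>\<^sup>+x. ennreal (g x) * ennreal (exp (- t * x)) \<partial>R)"
      unfolding \<mu>_def by (rule nn_integral_density[OF gm em])
    also have "\<dots> = (\<integral>\<^sup>+x. ennreal (g x) * ennreal (exp (- t * x)) * indicator {0..} x \<partial>lborel)"
      unfolding R_def by (rule nn_integral_restrict_space) simp
    also have "\<dots> = (\<integral>\<^sup>+x. ennreal (exp (- t * x) * g x) \<partial>lborel)"
    proof (rule nn_integral_cong)
      fix x :: real
      show "ennreal (g x) * ennreal (exp (- t * x)) * indicator {0..} x = ennreal (exp (- t * x) * g x)"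
        using zero[of x] g0[of x] by (cases "0 \<le> x") (simp_all add: ennreal_mult mult.commute)
    qed
    also have "\<dots> = ennreal (\<integral>x. exp (- t * x) * g x \<partial>lborel)"
      using int[OF t] g0 by (intro nn_integral_eq_integral) (auto simp: has_bochner_integral_iff)
    also have "(\<integral>x. exp (- t * x) * g x \<partial>lborel) = \<phi> t" using int[OF t] by (rule has_bochner_integral_integral_eq)
    finally show ?thesis .
  qed
  have "\<phi> t = (\<integral>x. exp (- t * x) \<partial>\<mu>)" if t: "0 \<le> t" for t
  proof -
    have "(\<lambda>x. exp (- t * x)) \<in> borel_measurable (restrict_space borel {0..})" by (intro measurable_restrict_space1) measurable
    then have m: "(\<lambda>x. exp (- t * x)) \<in> borel_measurable \<mu>" using measurable_cong_sets[OF trans[OF sets setsR] refl] by blast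
    have "0 \<le> (\<integral>x. exp (- t * x) * g x \<partial>lborel)"
      by (intro integral_nonneg_AE AE_I2 mult_nonneg_nonneg g0 exp_ge_zero)
    then have "0 \<le> \<phi> t"
      by (simp only: has_bochner_integral_integral_eq[OF int[OF t]])
    then have "has_bochner_integral \<mu> (\<lambda>x. exp (- t * x)) (\<phi> t)"
      by (intro has_bochner_integral_nn_integral m nn t) auto
    then show ?thesis by (simp add: has_bochner_integral_integral_eq)
  qed
  moreover have "finite_measure \<mu>"
  proof (rule finite_measureI)
    have "emeasure \<mu> (space \<mu>) = (\<integral>\<^sup>+x. ennreal (exp (- 0 * x)) \<partial>\<mu>)" by simp
    also have "\<dots> = ennreal (\<phi> 0)" by (rule nn) simp
    finally show "emeasure \<mu> (space \<mu>) \<noteq> \<infinity>" by simp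
  qed
  moreover have "log_concave_measure \<mu>"
    unfolding log_concave_measure_def \<mu>_def R_def using g measurable_restrict_space1 by blast
  ultimately show ?thesis using sets setsR by (intro exI[of _ \<mu>]) simp
qed

context log_concave_taylor
begin

text \<open>
  The representation extends from positive \<open>t\<close> to \<open>t = 0\<close> by continuity of \<open>\<phi>\<close>; for a density, monotone
  convergence along \<open>t = 1 / (i + 1)\<close> shows at the same time that it has finite mass.
\<close>
theorem represented:
  "\<exists>\<mu> :: real measure. sets \<mu> = sets (restrict_space borel {0..}) \<and> finite_measure \<mu> \<and>
     log_concave_measure \<mu> \<and> (\<forall>t\<ge>0. \<phi> t = (\<integral>x. exp (- t * x) \<partial>\<mu>))"
proof -
  define x where "x i = 1 / real (Suc i)" for i
  have x: "0 < x i" for i by (simp add: x_def)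
  have x0: "x \<longlonglongrightarrow> 0" unfolding x_def by (rule LIMSEQ_Suc[OF lim_1_over_n])
  have phi0: "(\<lambda>i. \<phi> (x i)) \<longlonglongrightarrow> \<phi> 0" by (rule tendsto_at_0[OF x0 less_imp_le[OF x]])
  from positive_times_representation show ?thesis
  proof
    assume "\<exists>c x0. 0 \<le> c \<and> 0 \<le> x0 \<and> (\<forall>s>0. \<phi> s = c * exp (- s * x0))"
    then obtain c y where c: "0 \<le> c" "0 \<le> y" and phi: "\<And>s. 0 < s \<Longrightarrow> \<phi> s = c * exp (- s * y)" by blast
    have "(\<lambda>i. c * exp (- x i * y)) \<longlonglongrightarrow> c * exp (- 0 * y)" by (intro tendsto_intros x0)
    moreover have "(\<lambda>i. c * exp (- x i * y)) \<longlonglongrightarrow> \<phi> 0" using phi0 unfolding phi[OF x] .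
    ultimately have "\<phi> 0 = c * exp (- 0 * y)" by (rule LIMSEQ_unique[symmetric])
    then have "\<phi> t = c * exp (- t * y)" if "0 \<le> t" for t using phi[of t] that by (cases "t = 0") auto
    from dirac_measure_represents[OF c this] show ?thesis .
  next
    assume "\<exists>g. g \<in> borel_measurable borel \<and> log_concave_on {0..} g \<and> (\<forall>x<0. g x = 0) \<and>
      (\<forall>s>0. integrable lborel (\<lambda>x. exp (- s * x) * g x) \<and> \<phi> s = (\<integral>x. exp (- s * x) * g x \<partial>lborel))"
    then obtain g where g: "g \<in> borel_measurable borel" "log_concave_on {0..} g" and zero: "\<And>x. x < 0 \<Longrightarrow> g x = 0"
      and int: "\<And>s. 0 < s \<Longrightarrow> integrable lborel (\<lambda>x. exp (- s * x) * g x)"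
      and phi: "\<And>s. 0 < s \<Longrightarrow> \<phi> s = (\<integral>x. exp (- s * x) * g x \<partial>lborel)" by blast
    have g0: "0 \<le> g y" for y using g(2) zero[of y] by (cases "0 \<le> y") (auto simp: log_concave_on_def)
    have lim: "(\<lambda>i. \<integral>y. exp (- x i * y) * g y \<partial>lborel) \<longlonglongrightarrow> \<phi> 0" using phi0 unfolding phi[OF x] .
    have mono: "mono (\<lambda>i. exp (- x i * y) * g y)" for y
    proof (cases "0 \<le> y")
      case True
      have "x j \<le> x i" if "i \<le> j" for i j using that by (simp add: x_def frac_le)
      then show ?thesis using True g0 by (intro monoI mult_right_mono) (auto intro: mult_right_mono)
    qed (simp add: zero mono_def)
    have conv: "(\<lambda>i. exp (- x i * y) * g y) \<longlonglongrightarrow> g y" for y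
    proof -
      have "(\<lambda>i. exp (- x i * y) * g y) \<longlonglongrightarrow> exp (- 0 * y) * g y" by (intro tendsto_intros x0)
      then show ?thesis by simp
    qed
    have "integrable lborel g \<and> (\<integral>y. g y \<partial>lborel) = \<phi> 0"
      using integral_monotone_convergence[OF int[OF x] AE_I2[OF mono] AE_I2[OF conv] lim] integrable_monotone_convergence[OF int[OF x] AE_I2[OF mono] AE_I2[OF conv] lim] g(1) by simp
    then have "has_bochner_integral lborel (\<lambda>y. exp (- t * y) * g y) (\<phi> t)" if "0 \<le> t" for t
      using that int[of t] phi[of t] by (cases "t = 0") (auto simp: has_bochner_integral_iff)
    from density_measure_represents[OF g this zero] show ?thesis .
  qed
qed

end

theorem theorem1p1:
  fixes \<phi> :: "real \<Rightarrow> real"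
  assumes "continuous_on {0..} \<phi>"
    and "\<And>n. (deriv ^^ n) \<phi> differentiable_on {0<..}"
  shows "(\<forall>t>0. log_concave_seq (taylor_seq \<phi> t)) \<longleftrightarrow>
         (\<exists>\<mu> :: real measure.
            sets \<mu> = sets (restrict_space borel {0..}) \<and> finite_measure \<mu> \<and>
            log_concave_measure \<mu> \<and>
            (\<forall>t\<ge>0. \<phi> t = (\<integral>x. exp (- t * x) \<partial>\<mu>)))"
proof
  assume "\<forall>t>0. log_concave_seq (taylor_seq \<phi> t)"
  then interpret log_concave_taylor \<phi> using assms by unfold_locales blast+
  show "\<exists>\<mu> :: real measure. sets \<mu> = sets (restrict_space borel {0..}) \<and> finite_measure \<mu> \<and>
            log_concave_measure \<mu> \<and> (\<forall>t\<ge>0. \<phi> t = (\<integral>x. exp (- t * x) \<partial>\<mu>))"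
    by (rule represented)
next
  assume "\<exists>\<mu> :: real measure. sets \<mu> = sets (restrict_space borel {0..}) \<and> finite_measure \<mu> \<and>
            log_concave_measure \<mu> \<and> (\<forall>t\<ge>0. \<phi> t = (\<integral>x. exp (- t * x) \<partial>\<mu>))"
  then show "\<forall>t>0. log_concave_seq (taylor_seq \<phi> t)"
    using log_concave_seq_taylor_of_log_concave_measure by blast
qed

end
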